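(* Let $e\ge0$, $n\ge1$, $(n,e)\ne(1,0)$, $d,m\ge2$, let $P(X,S)=S^d+f_{d-1}(X)S^{d-1}+\cdots+f_0(X)$, $Q(X,Y)=Y^m+g_{m-1}(X)Y^{m-1}+\cdots+g_0(X)$ with $f_i,g_j\in k[X]$, and let $R=R_{n,e,P,Q}=k[X,Y,Z]/\langle X^nY-P(X,Q(X,Y)-X^eZ)\rangle$. Let $x,y,z$ be the classes of $X,Y,Z$ in $R$, put $s=Q(x,y)-x^ez$, and let $\partial$ be the locally nilpotent $k$-derivation of $R$ given by $$\partial(x)=0,\qquad \partial(y)=x^e\frac{\partial P}{\partial s}(x,s),\qquad \partial(z)=\frac{\partial Q}{\partial y}(x,y)\,\frac{\partial P}{\partial s}(x,s)-x^n$$ (so that $\partial(s)=x^{n+e}$). Then: (1) The $\partial$-filtration $\mathcal F=\{\mathcal F_i\}_{i\in\mathbb N}$ is given by $$\mathcal F_{mdi+dj+l}=k[x]s^ly^jz^i+\mathcal F_{mdi+dj+l-1}$$ where $i\in\mathbb N$, $j\in\{0,\ldots,m-1\}$, $l\in\{0,\ldots,d-1\}$. (2) The associated graded algebra $\mathrm{Gr}(R)=\bigoplus_{i\in\mathbb N}R_{[i]}$, $R_{[i]}=\mathcal F_i/\mathcal F_{i-1}$, is generated as a $k$-algebra by $\overline x,\overline y,\overline z,\overline s$ (the images of $x,y,z,s$ under $\mathrm{gr}_\partial$) with relations $\overline x^n\overline y=\overline s^d$ and $\overline x^e\,\overline z=\overline y^m$; that is, $$\mathrm{Gr}(R)=k[X,Y,Z,S]/\langle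 X^nY-S^d,\ X^eZ-Y^m\rangle .$$ In addition $R_{[mdi+dj+l]}=k[\overline x]\,\overline s^l\,\overline y^j\,\overline z^i$ where $i\in\mathbb N$, $j\in\{0,\ldots,m-1\}$, $l\in\{0,\ldots,d-1\}$.
   Context: $k$ is a field of characteristic zero, $\mathbb N=\mathbb Z_{\ge0}$. The $\partial$-filtration of $R$ is $\mathcal F_i=\ker\partial^{i+1}$, with $\mathcal F_{-1}=0$. The associated graded algebra has product $(a+\mathcal F_{i-1})(b+\mathcal F_{j-1})=ab+\mathcal F_{i+j-1}$. For $0\ne a\in\mathcal F_i\setminus\mathcal F_{i-1}$, $\mathrm{gr}_\partial(a)=\overline a:=a+\mathcal F_{i-1}\in\mathcal F_i/\mathcal F_{i-1}$. *)

theory Defs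
  imports "HOL-Algebra.Algebra" "HOL-Algebra.Algebraic_Closure_Type"
begin

section \<open>Polynomial rings\<close>

text \<open>
  A polynomial in \<open>k[X][S]\<close> has type \<open>'k poly poly\<close>, the inner variable being \<open>X\<close>;
  \<open>k[X,Y,Z]\<close> is \<open>k[X][Y][Z]\<close> and \<open>k[X,Y,Z,S]\<close> is \<open>k[X][Y][Z][S]\<close>, with \<open>X\<close> innermost.
  These types are turned into \<open>HOL-Algebra\<close> rings by \<^const>\<open>ring_of_type_algebra\<close>.
\<close>

abbreviation Pol3 :: "'k::field poly poly poly ring" where "Pol3 \<equiv> ring_of_type_algebra"
abbreviation Pol4 :: "'k::field poly poly poly poly ring" where "Pol4 \<equiv> ring_of_type_algebra"

definition C3 :: "'k::field \<Rightarrow> 'k poly poly poly" where "C3 c = [:[:[:c:]:]:]"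
definition X3 :: "'k::field poly poly poly" where "X3 = [:[:[:0, 1:]:]:]"
definition Y3 :: "'k::field poly poly poly" where "Y3 = [:[:0, 1:]:]"
definition Z3 :: "'k::field poly poly poly" where "Z3 = [:0, 1:]"

definition C4 :: "'k::field \<Rightarrow> 'k poly poly poly poly" where "C4 c = [:C3 c:]"
definition X4 :: "'k::field poly poly poly poly" where "X4 = [:X3:]"
definition Y4 :: "'k::field poly poly poly poly" where "Y4 = [:Y3:]"
definition Z4 :: "'k::field poly poly poly poly" where "Z4 = [:Z3:]"
definition S4 :: "'k::field poly poly poly poly" where "S4 = [:0, 1:]"

section \<open>Algebras over a field\<close>

text \<open>
  A \<open>k\<close>-algebra is a ring record \<open>A\<close> together with its structure map \<open>\<kappa>\<close> from \<open>k\<close> to \<open>A\<close>.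
  \<open>eval2 A \<kappa> p a b\<close> is the value \<open>p(a,b)\<close>, with \<open>a\<close> substituted for the inner
  and \<open>b\<close> for the outer variable of \<open>p\<close>.
\<close>

definition eval2 ::
    "('a, 'm) ring_scheme \<Rightarrow> ('k::field \<Rightarrow> 'a) \<Rightarrow> 'k poly poly \<Rightarrow> 'a \<Rightarrow> 'a \<Rightarrow> 'a" where
  "eval2 A \<kappa> p a b =
     (\<Oplus>\<^bsub>A\<^esub>j\<in>{..Polynomial.degree p}.
        (\<Oplus>\<^bsub>A\<^esub>i\<in>{..Polynomial.degree (Polynomial.coeff p j)}. \<kappa> (Polynomial.coeff (Polynomial.coeff p j) i) \<otimes>\<^bsub>A\<^esub> a [^]\<^bsub>A\<^esub> i)
          \<otimes>\<^bsub>A\<^esub> b [^]\<^bsub>A\<^esub> j)"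

definition generated_algebra ::
    "('a, 'm) ring_scheme \<Rightarrow> ('k::field \<Rightarrow> 'a) \<Rightarrow> 'a set \<Rightarrow> 'a set" where
  "generated_algebra A \<kappa> T = generate_ring A (range \<kappa> \<union> T)"

definition k_derivation ::
    "('a, 'm) ring_scheme \<Rightarrow> ('k::field \<Rightarrow> 'a) \<Rightarrow> ('a \<Rightarrow> 'a) \<Rightarrow> bool" where
  "k_derivation A \<kappa> D \<longleftrightarrow>
     D \<in> carrier A \<rightarrow> carrier A \<and>
     (\<forall>a\<in>carrier A. \<forall>b\<in>carrier A. D (a \<oplus>\<^bsub>A\<^esub> b) = D a \<oplus>\<^bsub>A\<^esub> D b) \<and>
     (\<forall>c. \<forall>a\<in>carrier A. D (\<kappa> c \<otimes>\<^bsub>A\<^esub> a) = \<kappa> c \<otimes>\<^bsub>A\<^esub> D a) \<and>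
     (\<forall>a\<in>carrier A. \<forall>b\<in>carrier A.
        D (a \<otimes>\<^bsub>A\<^esub> b) = D a \<otimes>\<^bsub>A\<^esub> b \<oplus>\<^bsub>A\<^esub> a \<otimes>\<^bsub>A\<^esub> D b)"

definition locally_nilpotent :: "('a, 'm) ring_scheme \<Rightarrow> ('a \<Rightarrow> 'a) \<Rightarrow> bool" where
  "locally_nilpotent A D \<longleftrightarrow> (\<forall>a\<in>carrier A. \<exists>N. (D ^^ N) a = \<zero>\<^bsub>A\<^esub>)"

section \<open>The filtration of a locally nilpotent derivation and its associated graded algebra\<close>

text \<open>
  The index is an integer so that \<open>filtr A D (-1)\<close> is the kernel of the identity,
  i.e. the zero submodule.
\<close>

definition filtr :: "('a, 'm) ring_scheme \<Rightarrow> ('a \<Rightarrow> 'a) \<Rightarrow> int \<Rightarrow> 'a set" where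
  "filtr A D i = {a \<in> carrier A. (D ^^ nat (i + 1)) a = \<zero>\<^bsub>A\<^esub>}"

text \<open>
  The quotient group \<open>F\<^sub>i / F\<^sub>i\<^sub>-\<^sub>1\<close>. As for every quotient group of an additive group in
  \<open>HOL-Algebra\<close>, its operation (addition of cosets) is written multiplicatively.
\<close>

definition gr_part :: "('a, 'm) ring_scheme \<Rightarrow> ('a \<Rightarrow> 'a) \<Rightarrow> nat \<Rightarrow> 'a set monoid" where
  "gr_part A D i = (A\<lparr>carrier := filtr A D (int i)\<rparr>) A_Mod (filtr A D (int i - 1))"

text \<open>For \<open>a \<in> F\<^sub>i\<close>: the coset \<open>a + F\<^sub>i\<^sub>-\<^sub>1\<close>, placed in degree \<open>i\<close>.\<close>

definition gr_class :: "('a, 'm) ring_scheme \<Rightarrow> ('a \<Rightarrow> 'a) \<Rightarrow> nat \<Rightarrow> 'a \<Rightarrow> nat \<Rightarrow> 'a set" where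
  "gr_class A D i a =
     (\<lambda>j. if j = i then filtr A D (int i - 1) +>\<^bsub>A\<^esub> a else \<one>\<^bsub>gr_part A D j\<^esub>)"

text \<open>
  The product of the cosets \<open>U \<in> F\<^sub>i / F\<^sub>i\<^sub>-\<^sub>1\<close> and \<open>V \<in> F\<^sub>j / F\<^sub>j\<^sub>-\<^sub>1\<close> is the coset of
  \<open>F\<^sub>i\<^sub>+\<^sub>j\<^sub>-\<^sub>1\<close> given by multiplying representatives, as computed by \<^const>\<open>rcoset_mult\<close>. It is
  extended bilinearly to the direct sum; \<^const>\<open>finprod\<close> is thus a finite sum of cosets.
\<close>

definition Gr :: "('a, 'm) ring_scheme \<Rightarrow> ('a \<Rightarrow> 'a) \<Rightarrow> (nat \<Rightarrow> 'a set) ring" where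
  "Gr A D =
     \<lparr>carrier = carrier (sum_group UNIV (gr_part A D)),
      monoid.mult = (\<lambda>u v N. finprod (gr_part A D N)
         (\<lambda>i. rcoset_mult A (filtr A D (int N - 1)) (u i) (v (N - i))) {..N}),
      one = gr_class A D 0 \<one>\<^bsub>A\<^esub>,
      ring.zero = \<one>\<^bsub>sum_group UNIV (gr_part A D)\<^esub>,
      add = (\<otimes>\<^bsub>sum_group UNIV (gr_part A D)\<^esub>)\<rparr>"

definition gr_const ::
    "('a, 'm) ring_scheme \<Rightarrow> ('k::field \<Rightarrow> 'a) \<Rightarrow> ('a \<Rightarrow> 'a) \<Rightarrow> 'k \<Rightarrow> nat \<Rightarrow> 'a set" where
  "gr_const A \<kappa> D c = gr_class A D 0 (\<kappa> c)"

text \<open>The homogeneous part \<open>F\<^sub>i / F\<^sub>i\<^sub>-\<^sub>1\<close>, seen inside the direct sum.\<close>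

definition Gr_piece :: "('a, 'm) ring_scheme \<Rightarrow> ('a \<Rightarrow> 'a) \<Rightarrow> nat \<Rightarrow> (nat \<Rightarrow> 'a set) set" where
  "Gr_piece A D i = {u \<in> carrier (Gr A D). \<forall>j. j \<noteq> i \<longrightarrow> u j = \<one>\<^bsub>gr_part A D j\<^esub>}"

text \<open>
  For \<open>a \<noteq> 0\<close> the least \<open>i\<close> with \<open>a \<in> F\<^sub>i\<close> is the one with \<open>a \<in> F\<^sub>i - F\<^sub>i\<^sub>-\<^sub>1\<close>.
\<close>

definition gr :: "('a, 'm) ring_scheme \<Rightarrow> ('a \<Rightarrow> 'a) \<Rightarrow> 'a \<Rightarrow> nat \<Rightarrow> 'a set" where
  "gr A D a = gr_class A D (LEAST i. a \<in> filtr A D (int i)) a"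

section \<open>The algebras of the theorem\<close>

definition idealR ::
    "nat \<Rightarrow> nat \<Rightarrow> 'k::field poly poly \<Rightarrow> 'k poly poly \<Rightarrow> 'k poly poly poly set" where
  "idealR n e P Q =
     Idl\<^bsub>Pol3\<^esub> {X3 ^ n * Y3 - eval2 Pol3 C3 P X3 (eval2 Pol3 C3 Q X3 Y3 - X3 ^ e * Z3)}"

definition ringR ::
    "nat \<Rightarrow> nat \<Rightarrow> 'k::field poly poly \<Rightarrow> 'k poly poly \<Rightarrow> 'k poly poly poly set ring" where
  "ringR n e P Q = Pol3 Quot idealR n e P Q"

definition clsR ::
    "nat \<Rightarrow> nat \<Rightarrow> 'k::field poly poly \<Rightarrow> 'k poly poly \<Rightarrow> 'k poly poly poly \<Rightarrow> 'k poly poly poly set"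
  where "clsR n e P Q p = idealR n e P Q +>\<^bsub>Pol3\<^esub> p"

definition idealG :: "nat \<Rightarrow> nat \<Rightarrow> nat \<Rightarrow> nat \<Rightarrow> 'k::field poly poly poly poly set" where
  "idealG n e d m = Idl\<^bsub>Pol4\<^esub> {X4 ^ n * Y4 - S4 ^ d, X4 ^ e * Z4 - Y4 ^ m}"

definition ringG :: "nat \<Rightarrow> nat \<Rightarrow> nat \<Rightarrow> nat \<Rightarrow> 'k::field poly poly poly poly set ring" where
  "ringG n e d m = Pol4 Quot idealG n e d m"

definition clsG ::
    "nat \<Rightarrow> nat \<Rightarrow> nat \<Rightarrow> nat \<Rightarrow> 'k::field poly poly poly poly \<Rightarrow> 'k poly poly poly poly set"
  where "clsG n e d m p = idealG n e d m +>\<^bsub>Pol4\<^esub> p"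

end

theory Submission
  imports Defs
begin

text \<open>
  After inverting \<open>x\<close> the algebra \<open>R\<close> becomes \<open>k[x,1/x][s]\<close>: the defining relations give
  \<open>y = P(x,s)/x\<^sup>n\<close> and \<open>z = (Q(x,y) - s)/x\<^sup>e\<close>, and the derivation becomes \<open>x\<^sup>n\<^sup>+\<^sup>e d/ds\<close>. In
  characteristic zero the \<open>i\<close>-th step of its filtration therefore consists of the elements of
  degree at most \<open>i\<close> in \<open>s\<close>, provided that \<open>R\<close> really embeds into \<open>K[S]\<close>, where \<open>K\<close> is a field
  containing \<open>k[x]\<close> (Laurent series are used below).

  Both the embedding and the shape of the filtration rest on one normal form. Rewriting
  \<open>s\<^sup>d = x\<^sup>n y - \<dots>\<close> and \<open>y\<^sup>m = x\<^sup>e z + s - \<dots>\<close> brings every element into a \<open>k[x]\<close>-linear combination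
  of the monomials \<open>s\<^sup>l y\<^sup>j z\<^sup>i\<close> with \<open>l < d\<close> and \<open>j < m\<close> (lemma \<open>monomial_in_span\<close>). The image of
  such a monomial in \<open>K[S]\<close> has degree \<open>m d i + d j + l\<close>, and by uniqueness of division with
  remainder each natural number is the degree of exactly one of them. Leading terms thus never
  cancel: a combination that maps to zero is trivial, so the kernel of the map to \<open>K[S]\<close> is the
  defining ideal (\<open>chi_eq_0_iff\<close>), and a combination of degree at most \<open>N\<close> only involves
  monomials of degree at most \<open>N\<close> (\<open>degree_le_imp_span\<close>). This is the description of the
  filtration.

  Sending a class of degree \<open>i\<close> to its leading term identifies the associated graded ring with a
  graded subring of \<open>K[S]\<close>, whose part of degree \<open>i\<close> is \<open>k[x] \<xi>\<^sub>i S\<^sup>i\<close> with \<open>\<xi>\<^sub>i\<close> the leading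
  coefficient of the monomial of degree \<open>i\<close>. The algebra \<open>k[X,Y,Z,S]/(X\<^sup>nY - S\<^sup>d, X\<^sup>eZ - Y\<^sup>m)\<close> has
  relations of the same form with \<open>P = S\<^sup>d\<close>, \<open>Q = Y\<^sup>m\<close> and without the linear term \<open>s\<close>. The same
  normal form argument, with the same \<open>\<xi>\<^sub>i\<close>, shows that it embeds into \<open>K[S]\<close>, and its
  image is the same subring (\<open>range_theta\<close>). Hence the two are isomorphic.
\<close>

section \<open>Substitution homomorphisms on polynomial rings\<close>

locale ring_map =
  fixes h :: "'a::comm_ring_1 \<Rightarrow> 'b::comm_ring_1"
  assumes map_1 [simp]: "h 1 = 1"
    and map_add [simp]: "h (a + b) = h a + h b"
    and map_mult [simp]: "h (a * b) = h a * h b"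
begin

lemma map_0 [simp]: "h 0 = 0"
  using map_add[of 0 0] by simp

lemma map_minus [simp]: "h (- a) = - h a"
  using map_add[of a "- a"] by (simp add: eq_neg_iff_add_eq_0 add.commute)

lemma map_diff [simp]: "h (a - b) = h a - h b"
  using map_add[of a "- b"] by simp

lemma map_power [simp]: "h (a ^ N) = h a ^ N"
  by (induction N) auto

lemma map_sum: "h (sum u A) = (\<Sum>i\<in>A. h (u i))"
  by (induction A rule: infinite_finite_induct) auto

end

text \<open>
  The universal property of a polynomial ring. Iterating it, one variable at a time, produces the
  homomorphisms out of \<open>k[X][Y][Z]\<close> and \<open>k[X][Y][Z][S]\<close>.
\<close>

definition subst :: "('a::comm_ring_1 \<Rightarrow> 'b::comm_ring_1) \<Rightarrow> 'b \<Rightarrow> 'a poly \<Rightarrow> 'b" where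
  "subst h b p = poly (map_poly h p) b"

context ring_map
begin

lemma subst_0 [simp]: "subst h b 0 = 0"
  by (simp add: subst_def)

lemma subst_pCons [simp]: "subst h b (pCons c p) = h c + b * subst h b p"
  by (simp add: subst_def map_poly_pCons)

lemma subst_add: "subst h b (p + q) = subst h b p + subst h b q"
  by (induction p q rule: poly_induct2) (auto simp: algebra_simps)

lemma subst_smult: "subst h b (Polynomial.smult c p) = h c * subst h b p"
  by (induction p) (auto simp: algebra_simps)

lemma subst_mult: "subst h b (p * q) = subst h b p * subst h b q"
  by (induction p) (auto simp: algebra_simps subst_add subst_smult)

lemma ring_map_subst: "ring_map (subst h b)"
  by unfold_locales (auto simp: subst_add subst_mult one_pCons)

lemma subst_monom: "subst h b (Polynomial.monom c N) = h c * b ^ N"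
  by (induction N) (auto simp: Polynomial.monom_0 monom_Suc algebra_simps)

lemma subst_eq_sum: "subst h b p = (\<Sum>j\<le>Polynomial.degree p. h (Polynomial.coeff p j) * b ^ j)"
proof -
  interpret S: ring_map "subst h b" by (rule ring_map_subst)
  have "subst h b p = subst h b (\<Sum>j\<le>Polynomial.degree p. Polynomial.monom (Polynomial.coeff p j) j)"
    by (simp only: poly_as_sum_of_monoms)
  then show ?thesis by (simp only: S.map_sum subst_monom)
qed

end

lemma ring_map_const: "ring_map (\<lambda>c. [:c:])"
  by unfold_locales (auto simp: one_pCons)

lemma ring_map_compose:
  assumes "ring_map h" "ring_map k" shows "ring_map (\<lambda>a. k (h a))"
proof -
  interpret h: ring_map h by fact
  interpret k: ring_map k by fact
  show ?thesis by unfold_locales auto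
qed

text \<open>
  A polynomial ring is generated by its constants and its variable, so a property that passes to
  sums and products only has to be checked there.
\<close>

lemma poly_generated_induct:
  fixes p :: "'a::comm_ring_1 poly"
  assumes "\<And>c. T [:c:]" "T [:0, 1:]"
    and "\<And>a b. T a \<Longrightarrow> T b \<Longrightarrow> T (a + b)" "\<And>a b. T a \<Longrightarrow> T b \<Longrightarrow> T (a * b)"
  shows "T p"
proof (induction p)
  case 0
  show ?case using assms(1)[of 0] by simp
next
  case (pCons c p)
  have "pCons c p = [:c:] + [:0, 1:] * p" by simp
  then show ?case using assms pCons by metis
qed

text \<open>
  Two derivations along the same map \<open>v\<close> are determined by their values on generators. For an
  iterated polynomial ring this is applied once for each variable.
\<close>

lemma derivation_along_eqI:
  fixes v :: "'a::comm_ring_1 poly \<Rightarrow> 'b::comm_ring_1"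
  assumes add: "\<And>p q. \<Delta> (p + q) = \<Delta> p + \<Delta> q" "\<And>p q. \<Delta>' (p + q) = \<Delta>' p + \<Delta>' q"
    and mult: "\<And>p q. \<Delta> (p * q) = \<Delta> p * v q + v p * \<Delta> q"
      "\<And>p q. \<Delta>' (p * q) = \<Delta>' p * v q + v p * \<Delta>' q"
    and "\<And>c. \<Delta> [:c:] = \<Delta>' [:c:]" "\<Delta> [:0, 1:] = \<Delta>' [:0, 1:]"
  shows "\<Delta> p = \<Delta>' p"
  by (induction p rule: poly_generated_induct) (simp_all add: assms)

section \<open>Normal forms modulo the two defining relations\<close>

text \<open>
  In an algebra over a ring \<open>C\<close>, let
  \<open>s\<^sup>d = A y - \<Sum> f\<^sub>t s\<^sup>t\<close> and \<open>y\<^sup>m = E z + w s - \<Sum> g\<^sub>t y\<^sup>t\<close>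
  modulo an ideal \<open>I\<close>. Both the algebra \<open>R\<close> (with \<open>w = 1\<close>) and its graded counterpart
  (with \<open>f = g = 0\<close> and \<open>w = 0\<close>) are of this form, so they are treated together.
  The coefficients \<open>A\<close> and \<open>E\<close> stand for \<open>x\<^sup>n\<close> and \<open>x\<^sup>e\<close>.
\<close>

locale two_relations = ring_map h
  for h :: "'c::comm_ring_1 \<Rightarrow> 'b::comm_ring_1" +
  fixes I :: "'b set" and s y z :: 'b and d m :: nat and A E w :: 'c and f g :: "nat \<Rightarrow> 'c"
  assumes I_0: "0 \<in> I" and I_add: "a \<in> I \<Longrightarrow> a' \<in> I \<Longrightarrow> a + a' \<in> I"
    and I_mult: "a \<in> I \<Longrightarrow> c * a \<in> I"
    and d2: "d \<ge> 2" and m2: "m \<ge> 2"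
    and rel_s: "s ^ d - (h A * y - (\<Sum>t<d. h (f t) * s ^ t)) \<in> I"
    and rel_y: "y ^ m - (h E * z + h w * s - (\<Sum>t<m. h (g t) * y ^ t)) \<in> I"
begin

text \<open>
  Give \<open>s\<close>, \<open>y\<close>, \<open>z\<close> the weights \<open>1\<close>, \<open>d\<close>, \<open>m d\<close>. The monomials with exponent of
  \<open>s\<close> below \<open>d\<close> and exponent of \<open>y\<close> below \<open>m\<close> have pairwise different weights, and every
  natural number occurs; they are therefore indexed by their weight.
\<close>

definition nmon :: "nat \<Rightarrow> 'b" where
  "nmon t = s ^ (t mod d) * y ^ ((t div d) mod m) * z ^ (t div (m * d))"

lemma weight_digits:
  assumes "l < d" "j < m"
  shows "(m * d * i + d * j + l) mod d = l" "((m * d * i + d * j + l) div d) mod m = j"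
    "(m * d * i + d * j + l) div (m * d) = i"
proof -
  have e: "m * d * i + d * j + l = d * (m * i + j) + l" by (simp add: algebra_simps)
  show "(m * d * i + d * j + l) mod d = l" unfolding e using assms by simp
  have q: "(m * d * i + d * j + l) div d = m * i + j" unfolding e using assms by simp
  show "((m * d * i + d * j + l) div d) mod m = j" unfolding q using assms by simp
  have "(m * d * i + d * j + l) div (m * d) = (m * d * i + d * j + l) div d div m"
    by (simp add: div_mult2_eq mult.commute)
  then show "(m * d * i + d * j + l) div (m * d) = i" unfolding q using assms by simp
qed

lemma nmon_weight:
  "l < d \<Longrightarrow> j < m \<Longrightarrow> nmon (m * d * i + d * j + l) = s ^ l * y ^ j * z ^ i"
  unfolding nmon_def by (simp only: weight_digits)

definition span_upto :: "nat \<Rightarrow> 'b set" where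
  "span_upto N = {a. \<exists>c. a - (\<Sum>t\<le>N. h (c t) * nmon t) \<in> I}"

lemma span_cong: "a - a' \<in> I \<Longrightarrow> a' \<in> span_upto N \<Longrightarrow> a \<in> span_upto N"
proof -
  assume 1: "a - a' \<in> I" and "a' \<in> span_upto N"
  then obtain c where "a' - (\<Sum>t\<le>N. h (c t) * nmon t) \<in> I" unfolding span_upto_def by auto
  from I_add[OF 1 this] show ?thesis unfolding span_upto_def by auto
qed

lemma span_sum: "(\<Sum>t\<le>N. h (c t) * nmon t) \<in> span_upto N"
  unfolding span_upto_def using I_0 by (auto intro!: exI[of _ c])

lemma span_0: "0 \<in> span_upto N"
  using span_sum[where c = "\<lambda>_. 0"] by simp

lemma span_add: "a \<in> span_upto N \<Longrightarrow> a' \<in> span_upto N \<Longrightarrow> a + a' \<in> span_upto N"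
proof -
  assume "a \<in> span_upto N" "a' \<in> span_upto N"
  then obtain c c' where *: "a - (\<Sum>t\<le>N. h (c t) * nmon t) \<in> I" "a' - (\<Sum>t\<le>N. h (c' t) * nmon t) \<in> I"
    unfolding span_upto_def by auto
  have "a + a' - (\<Sum>t\<le>N. h (c t + c' t) * nmon t)
      = (a - (\<Sum>t\<le>N. h (c t) * nmon t)) + (a' - (\<Sum>t\<le>N. h (c' t) * nmon t))"
    by (simp add: algebra_simps sum.distrib)
  then show ?thesis using I_add[OF *] unfolding span_upto_def mem_Collect_eq by metis
qed

lemma span_scale: "a \<in> span_upto N \<Longrightarrow> h r * a \<in> span_upto N"
proof -
  assume "a \<in> span_upto N"
  then obtain c where *: "a - (\<Sum>t\<le>N. h (c t) * nmon t) \<in> I"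
    unfolding span_upto_def by auto
  have "h r * a - (\<Sum>t\<le>N. h (r * c t) * nmon t) = h r * (a - (\<Sum>t\<le>N. h (c t) * nmon t))"
    by (simp add: algebra_simps sum_distrib_left)
  then show ?thesis using I_mult[OF *] unfolding span_upto_def
    by (auto intro!: exI[of _ "\<lambda>t. r * c t"])
qed

lemma span_diff: "a \<in> span_upto N \<Longrightarrow> a' \<in> span_upto N \<Longrightarrow> a - a' \<in> span_upto N"
  using span_add[of a N "- a'"] span_scale[of a' N "-1"] by simp

lemma span_sumI: "(\<And>t. t \<in> T \<Longrightarrow> u t \<in> span_upto N) \<Longrightarrow> sum u T \<in> span_upto N"
  by (induction T rule: infinite_finite_induct) (auto simp: span_0 span_add)

lemma span_mono: "N \<le> N' \<Longrightarrow> a \<in> span_upto N \<Longrightarrow> a \<in> span_upto N'"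
proof -
  assume le: "N \<le> N'" and "a \<in> span_upto N"
  then obtain c where *: "a - (\<Sum>t\<le>N. h (c t) * nmon t) \<in> I"
    unfolding span_upto_def by auto
  have "(\<Sum>t\<le>N'. h (if t \<le> N then c t else 0) * nmon t) = (\<Sum>t\<le>N. h (c t) * nmon t)"
    using le by (intro sum.mono_neutral_cong_right) auto
  then show ?thesis using * unfolding span_upto_def
    by (auto intro!: exI[of _ "\<lambda>t. if t \<le> N then c t else 0"])
qed

lemma span_nmon: "nmon N \<in> span_upto N"
proof -
  have "(\<Sum>t\<le>N. h (if t = N then 1 else 0) * nmon t) = (\<Sum>t\<in>{N}. nmon t)"
    by (rule sum.mono_neutral_cong_right) auto
  then have "(\<Sum>t\<le>N. h (if t = N then 1 else 0) * nmon t) = nmon N" by simp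
  then show ?thesis using span_sum[where c = "\<lambda>t. if t = N then 1 else 0"] by metis
qed

text \<open>
  Rewriting \<open>s\<^sup>d\<close> and \<open>y\<^sup>m\<close> by the relations replaces a monomial by one of the same weight with
  fewer factors (this is where \<open>d, m \<ge> 2\<close> enters), plus terms of smaller weight. Hence the
  rewriting terminates and never increases the weight.
\<close>

lemma monomial_in_span: "s ^ l * y ^ j * z ^ i \<in> span_upto (m * d * i + d * j + l)"
proof (induction "m * d * i + d * j + l" arbitrary: l j i rule: less_induct)
  case less
  note lower = less
  have lower': "s ^ l' * y ^ j' * z ^ i' \<in> span_upto (m * d * i + d * j + l)"
    if "m * d * i' + d * j' + l' < m * d * i + d * j + l" for l' j' i'
    using lower[OF that] that by (intro span_mono[of _ "m * d * i + d * j + l"]) auto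
  have same: "s ^ l' * y ^ j' * z ^ i' \<in> span_upto (m * d * i + d * j + l)"
    if "m * d * i' + d * j' + l' = m * d * i + d * j + l" for l' j' i'
    using that
  proof (induction "l' + j' + i'" arbitrary: l' j' i' rule: less_induct)
    case less
    have red: "s ^ l'' * y ^ j'' * z ^ i'' \<in> span_upto (m * d * i + d * j + l)"
      if "m * d * i'' + d * j'' + l'' = m * d * i + d * j + l" "l'' + j'' + i'' < l' + j' + i'"
      for l'' j'' i'' using less.hyps[OF that(2,1)] .
    consider "l' \<ge> d" | "j' \<ge> m" | "l' < d" "j' < m" by linarith
    then show ?case
    proof cases
      case 1
      define p where "p = l' - d"
      have l': "l' = d + p" using 1 by (simp add: p_def)
      let ?c = "s ^ p * y ^ j' * z ^ i'"
      have "?c * (s ^ d - (h A * y - (\<Sum>t<d. h (f t) * s ^ t))) \<in> I" by (rule I_mult[OF rel_s])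
      also have "?c * (s ^ d - (h A * y - (\<Sum>t<d. h (f t) * s ^ t))) = s ^ l' * y ^ j' * z ^ i' -
          (h A * (s ^ p * y ^ Suc j' * z ^ i') - (\<Sum>t<d. h (f t) * (s ^ (p + t) * y ^ j' * z ^ i')))"
        by (simp add: l' algebra_simps power_add sum_distrib_left)
      finally show ?thesis
      proof (rule span_cong)
        show "h A * (s ^ p * y ^ Suc j' * z ^ i') - (\<Sum>t<d. h (f t) * (s ^ (p + t) * y ^ j' * z ^ i'))
          \<in> span_upto (m * d * i + d * j + l)"
          using less.prems d2
          by (intro span_diff span_scale span_sumI red lower') (auto simp: l' algebra_simps)
      qed
    next
      case 2
      define p where "p = j' - m"
      have j': "j' = m + p" using 2 by (simp add: p_def)
      let ?c = "s ^ l' * y ^ p * z ^ i'"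
      have md: "1 < d * m" using d2 m2 by (metis One_nat_def Suc_1 Suc_le_lessD less_1_mult)
      have "?c * (y ^ m - (h E * z + h w * s - (\<Sum>t<m. h (g t) * y ^ t))) \<in> I" by (rule I_mult[OF rel_y])
      also have "?c * (y ^ m - (h E * z + h w * s - (\<Sum>t<m. h (g t) * y ^ t))) = s ^ l' * y ^ j' * z ^ i' -
          (h E * (s ^ l' * y ^ p * z ^ Suc i') + h w * (s ^ Suc l' * y ^ p * z ^ i')
           - (\<Sum>t<m. h (g t) * (s ^ l' * y ^ (p + t) * z ^ i')))"
        by (simp add: j' algebra_simps power_add sum_distrib_left)
      finally show ?thesis
      proof (rule span_cong)
        have a: "s ^ l' * y ^ p * z ^ Suc i' \<in> span_upto (m * d * i + d * j + l)"
          using less.prems m2 by (intro red) (auto simp: j' algebra_simps)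
        have b: "s ^ Suc l' * y ^ p * z ^ i' \<in> span_upto (m * d * i + d * j + l)"
          using less.prems md by (intro lower') (auto simp: j' algebra_simps)
        have c: "s ^ l' * y ^ (p + t) * z ^ i' \<in> span_upto (m * d * i + d * j + l)" if "t < m" for t
        proof (rule lower')
          have "d * t < d * m" using that d2 by simp
          then show "m * d * i' + d * (p + t) + l' < m * d * i + d * j + l"
            using less.prems unfolding j' distrib_left mult.commute[of m d] by linarith
        qed
        show "h E * (s ^ l' * y ^ p * z ^ Suc i') + h w * (s ^ Suc l' * y ^ p * z ^ i')
           - (\<Sum>t<m. h (g t) * (s ^ l' * y ^ (p + t) * z ^ i')) \<in> span_upto (m * d * i + d * j + l)"
          by (intro span_diff span_add span_scale span_sumI a b c) simp
      qed
    next
      case 3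
      have "nmon (m * d * i' + d * j' + l') \<in> span_upto (m * d * i + d * j + l)"
        using span_nmon[of "m * d * i' + d * j' + l'"] by (simp only: less.prems)
      then show ?thesis using 3 by (simp only: nmon_weight)
    qed
  qed
  show ?case by (rule same) simp
qed

definition spanned :: "'b set" where "spanned = (\<Union>N. span_upto N)"

lemma spanned_monomial: "s ^ l * y ^ j * z ^ i \<in> spanned"
  using monomial_in_span unfolding spanned_def by blast

lemma spanned_scalar: "h r \<in> spanned"
  using span_scale[OF monomial_in_span[of 0 0 0], of r] unfolding spanned_def by auto

lemma spanned_add: "a \<in> spanned \<Longrightarrow> a' \<in> spanned \<Longrightarrow> a + a' \<in> spanned"
proof -
  assume "a \<in> spanned" "a' \<in> spanned"
  then obtain M N where "a \<in> span_upto M" "a' \<in> span_upto N" unfolding spanned_def by auto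
  then have "a + a' \<in> span_upto (max M N)" by (intro span_add span_mono[of _ "max M N"]) auto
  then show ?thesis unfolding spanned_def by blast
qed

lemma spanned_scale: "a \<in> spanned \<Longrightarrow> h r * a \<in> spanned"
  unfolding spanned_def by (auto intro: span_scale)

lemma spanned_sumI: "(\<And>t. t \<in> T \<Longrightarrow> u t \<in> spanned) \<Longrightarrow> sum u T \<in> spanned"
  using spanned_scalar[of 0] by (induction T rule: infinite_finite_induct) (auto simp: spanned_add)

lemma spanned_cong: "a - a' \<in> I \<Longrightarrow> a' \<in> spanned \<Longrightarrow> a \<in> spanned"
  unfolding spanned_def by (auto intro: span_cong)

text \<open>
  A product of two normal monomials is again a monomial in \<open>s, y, z\<close>, though in general not a
  normal one, so it is covered by the rewriting argument. The elements with a normal form thus make up a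
  subring, and it suffices to find generators in it.
\<close>

lemma spanned_mult:
  assumes "a \<in> spanned" "a' \<in> spanned"
  shows "a * a' \<in> spanned"
proof -
  obtain M c where c: "a - (\<Sum>t\<le>M. h (c t) * nmon t) \<in> I" (is "a - ?a \<in> I")
    using assms(1) by (auto simp: spanned_def span_upto_def)
  obtain N c' where c': "a' - (\<Sum>t\<le>N. h (c' t) * nmon t) \<in> I" (is "a' - ?b \<in> I")
    using assms(2) by (auto simp: spanned_def span_upto_def)
  have "a * a' - ?a * ?b = a' * (a - ?a) + ?a * (a' - ?b)" by (simp add: algebra_simps)
  then have 1: "a * a' - ?a * ?b \<in> I" using c c' by (simp add: I_add I_mult)
  have "nmon t * nmon t' \<in> spanned" for t t'
    using spanned_monomial[of "t mod d + t' mod d" "(t div d) mod m + (t' div d) mod m"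
        "t div (m * d) + t' div (m * d)"]
    by (simp add: nmon_def power_add algebra_simps)
  then have "(\<Sum>t\<le>M. \<Sum>t'\<le>N. h (c t * c' t') * (nmon t * nmon t')) \<in> spanned"
    by (intro spanned_sumI spanned_scale)
  also have "(\<Sum>t\<le>M. \<Sum>t'\<le>N. h (c t * c' t') * (nmon t * nmon t')) = ?a * ?b"
    unfolding sum_product by (intro sum.cong refl) (simp add: mult_ac)
  finally show ?thesis by (rule spanned_cong[OF 1])
qed

end

section \<open>Leading coefficients of the normal forms\<close>

text \<open>
  Suppose that the algebra also maps to \<open>K[S]\<close>, killing \<open>I\<close> and sending \<open>s\<close> to \<open>S\<close>.
  The relations then force the weight of a normal monomial to be the degree of its image. As the
  weights differ, no leading terms can cancel, and the weight filtration becomes the degree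
  filtration.
\<close>

locale two_relations_eval = two_relations h I s y z d m A E w f g
  for h :: "'c::idom \<Rightarrow> 'b::comm_ring_1" and I s y z d m A E w f g +
  fixes \<iota> :: "'c \<Rightarrow> 'K::field_char_0" and \<chi> :: "'b \<Rightarrow> 'K poly"
  assumes iota: "ring_map \<iota>" and iota_inj: "inj \<iota>" and chi: "ring_map \<chi>"
    and chi_h: "\<chi> (h c) = [:\<iota> c:]" and chi_s: "\<chi> s = [:0, 1:]"
    and chi_I: "a \<in> I \<Longrightarrow> \<chi> a = 0"
    and AE: "A \<noteq> 0" "E \<noteq> 0"
    and spanned_UNIV: "spanned = UNIV"
begin

sublocale iota: ring_map \<iota> by (rule iota)
sublocale chi: ring_map \<chi> by (rule chi)

lemma iota_eq_0 [simp]: "\<iota> c = 0 \<longleftrightarrow> c = 0"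
  using iota_inj by (metis injD iota.map_0)

text \<open>
  Each relation expresses a multiple \<open>a u\<close> of the next variable as a known polynomial \<open>p\<close> plus terms
  \<open>v\<close> of smaller degree; this yields the leading term of \<open>u\<close>.
\<close>

lemma leading_term_of_solution:
  fixes p u v :: "'K poly"
  assumes "p \<noteq> 0" "\<And>t. t \<ge> Polynomial.degree p \<Longrightarrow> Polynomial.coeff v t = 0"
    and "[:a:] * u = p + v" "a \<noteq> 0"
  shows "Polynomial.degree u = Polynomial.degree p" "lead_coeff u = lead_coeff p / a"
proof -
  have *: "a * Polynomial.coeff u t = Polynomial.coeff p t + Polynomial.coeff v t" for t
    using arg_cong[OF assms(3), of "\<lambda>q. Polynomial.coeff q t"] by simp
  show "Polynomial.degree u = Polynomial.degree p"
  proof (rule antisym)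
    show "Polynomial.degree u \<le> Polynomial.degree p"
      using * assms(2,4) by (intro degree_le) (metis add.right_neutral coeff_eq_0 less_imp_le mult_eq_0_iff)
    have "a * Polynomial.coeff u (Polynomial.degree p) \<noteq> 0" using * assms(1,2) by simp
    then show "Polynomial.degree p \<le> Polynomial.degree u" by (intro le_degree) auto
  qed
  then show "lead_coeff u = lead_coeff p / a" using *[of "Polynomial.degree p"] assms(2,4)
    by (simp add: field_simps)
qed

lemma chi_rel_s: "[:\<iota> A:] * \<chi> y = [:0, 1:] ^ d + (\<Sum>t<d. [:\<iota> (f t):] * [:0, 1:] ^ t)"
  using chi_I[OF rel_s] by (simp add: chi_h chi_s chi.map_sum algebra_simps del: mult_pCons_left mult_pCons_right)

lemma chi_rel_y: "[:\<iota> E:] * \<chi> z = \<chi> y ^ m + ((\<Sum>t<m. [:\<iota> (g t):] * \<chi> y ^ t) - [:\<iota> w:] * [:0, 1:])"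
  using chi_I[OF rel_y] by (simp add: chi_h chi_s chi.map_sum algebra_simps del: mult_pCons_left mult_pCons_right)

lemma X_power: "[:0, 1:] ^ t = (Polynomial.monom 1 t :: 'K poly)"
  by (simp add: Polynomial.monom_altdef)

lemma chi_y: "Polynomial.degree (\<chi> y) = d" "lead_coeff (\<chi> y) = inverse (\<iota> A)"
proof -
  have "Polynomial.coeff (\<Sum>t<d. [:\<iota> (f t):] * Polynomial.monom 1 t) u = 0" if "u \<ge> d" for u
    using that by (auto simp: Polynomial.coeff_sum coeff_monom)
  then show "Polynomial.degree (\<chi> y) = d" "lead_coeff (\<chi> y) = inverse (\<iota> A)"
    using leading_term_of_solution[OF _ _ chi_rel_s] AE
    by (simp_all add: X_power Polynomial.degree_monom_eq field_simps)
qed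

lemma chi_z: "Polynomial.degree (\<chi> z) = m * d" "lead_coeff (\<chi> z) = inverse (\<iota> A ^ m * \<iota> E)"
proof -
  have nz: "\<chi> y \<noteq> 0" using chi_y(1) d2 by auto
  then have deg: "Polynomial.degree (\<chi> y ^ t) = t * d" for t
    by (simp add: degree_power_eq chi_y(1))
  \<comment> \<open>Since \<open>S\<close> has degree \<open>1 < m d\<close>, the linear term does not reach the leading term.\<close>
  have "m * d > 1" using d2 m2 by (metis One_nat_def Suc_1 Suc_le_lessD less_1_mult)
  then have w: "Polynomial.coeff ([:\<iota> w:] * [:0, 1:]) u = 0" if "u \<ge> m * d" for u
    using that by (intro coeff_eq_0) simp
  have g: "Polynomial.coeff ([:\<iota> (g t):] * \<chi> y ^ t) u = 0" if "u \<ge> m * d" "t < m" for t u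
  proof -
    have "t * d < m * d" using that d2 by simp
    then have "Polynomial.degree (\<chi> y ^ t) < u" using that deg[of t] by linarith
    then have "Polynomial.coeff (\<chi> y ^ t) u = 0" by (rule coeff_eq_0)
    then show ?thesis by simp
  qed
  have 1: "Polynomial.coeff ((\<Sum>t<m. [:\<iota> (g t):] * \<chi> y ^ t) - [:\<iota> w:] * [:0, 1:]) u = 0" if "u \<ge> m * d" for u
    unfolding Polynomial.coeff_sum Polynomial.coeff_diff w[OF that] diff_0_right
    by (intro sum.neutral ballI g that) simp
  note solve = leading_term_of_solution[OF _ _ chi_rel_y]
  have "Polynomial.degree (\<chi> z) = Polynomial.degree (\<chi> y ^ m)"
    by (rule solve(1)) (use AE 1 nz deg in simp_all)
  then show "Polynomial.degree (\<chi> z) = m * d" by (simp only: deg)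
  have "lead_coeff (\<chi> z) = lead_coeff (\<chi> y ^ m) / \<iota> E"
    by (rule solve(2)) (use AE 1 nz deg in simp_all)
  also have "\<dots> = inverse (\<iota> A ^ m * \<iota> E)"
    unfolding lead_coeff_power chi_y(2) using AE by (simp add: field_simps)
  finally show "lead_coeff (\<chi> z) = inverse (\<iota> A ^ m * \<iota> E)" .
qed

text \<open>
  The leading coefficient of the image of the normal monomial of weight \<open>t\<close>. It is defined by a
  formula in \<open>A, E, d, m\<close> alone, which makes it the same for all lower order terms \<open>f, g, w\<close>.
\<close>

definition \<xi> :: "nat \<Rightarrow> 'K" where
  "\<xi> t = inverse (\<iota> A) ^ ((t div d) mod m) * inverse (\<iota> A ^ m * \<iota> E) ^ (t div (m * d))"

lemma xi_nonzero [simp]: "\<xi> t \<noteq> 0"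
  using AE by (simp add: \<xi>_def)

lemma chi_nmon: "Polynomial.degree (\<chi> (nmon t)) = t" "lead_coeff (\<chi> (nmon t)) = \<xi> t"
proof -
  have nz: "\<chi> y \<noteq> 0" "\<chi> z \<noteq> 0" using chi_y chi_z d2 m2 by auto
  have "Polynomial.degree (\<chi> (nmon t)) = t mod d + (t div d) mod m * d + t div (m * d) * (m * d)"
    using nz by (simp add: nmon_def chi_s degree_mult_eq degree_power_eq chi_y chi_z)
  also have "\<dots> = t"
  proof -
    have "t = t div d * d + t mod d" by simp
    also have "t div d = t div d div m * m + (t div d) mod m" by simp
    also have "t div d div m = t div (m * d)" by (simp add: div_mult2_eq mult.commute)
    finally show ?thesis by (simp add: algebra_simps)
  qed
  finally show "Polynomial.degree (\<chi> (nmon t)) = t" .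
  show "lead_coeff (\<chi> (nmon t)) = \<xi> t"
    using chi_y(2) chi_z(2) by (simp add: nmon_def chi_s \<xi>_def lead_coeff_mult lead_coeff_power)
qed

lemma chi_sum: "\<chi> (\<Sum>t\<le>N. h (c t) * nmon t) = (\<Sum>t\<le>N. Polynomial.smult (\<iota> (c t)) (\<chi> (nmon t)))"
  by (simp add: chi.map_sum chi_h)

text \<open>
  The images of the normal monomials form a triangular system with respect to the powers of \<open>S\<close>:
  only the last summand contributes to the top coefficient.
\<close>

lemma coeff_chi_sum:
  "Polynomial.coeff (\<chi> (\<Sum>t\<le>N. h (c t) * nmon t)) N = \<iota> (c N) * \<xi> N"
  "u > N \<Longrightarrow> Polynomial.coeff (\<chi> (\<Sum>t\<le>N. h (c t) * nmon t)) u = 0"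
proof -
  have z: "Polynomial.coeff (\<chi> (nmon t)) u = 0" if "t < u" for t u
    using that by (intro coeff_eq_0) (simp add: chi_nmon)
  have "Polynomial.coeff (\<chi> (\<Sum>t\<le>N. h (c t) * nmon t)) N
      = (\<Sum>t\<in>{N}. \<iota> (c t) * Polynomial.coeff (\<chi> (nmon t)) N)"
    unfolding chi_sum Polynomial.coeff_sum coeff_smult
    by (rule sum.mono_neutral_right) (auto simp: z)
  then show "Polynomial.coeff (\<chi> (\<Sum>t\<le>N. h (c t) * nmon t)) N = \<iota> (c N) * \<xi> N"
    using chi_nmon[of N] by simp
  show "u > N \<Longrightarrow> Polynomial.coeff (\<chi> (\<Sum>t\<le>N. h (c t) * nmon t)) u = 0"
    unfolding chi_sum Polynomial.coeff_sum coeff_smult by (auto intro!: sum.neutral simp: z)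
qed

lemma chi_cong: "a - a' \<in> I \<Longrightarrow> \<chi> a = \<chi> a'"
  using chi_I[of "a - a'"] by simp

lemma top_coeff_0_imp_span_pred:
  assumes "a - (\<Sum>t\<le>M. h (c t) * nmon t) \<in> I" "Polynomial.coeff (\<chi> a) M = 0"
  shows "a - (\<Sum>t<M. h (c t) * nmon t) \<in> I"
proof -
  have "\<iota> (c M) * \<xi> M = 0"
    using assms(2) coeff_chi_sum(1)[of c M] by (simp add: chi_cong[OF assms(1)])
  then have "c M = 0" by simp
  then have "(\<Sum>t\<le>M. h (c t) * nmon t) = (\<Sum>t<M. h (c t) * nmon t)"
    by (simp add: lessThan_Suc_atMost[symmetric])
  then show ?thesis using assms(1) by simp
qed

text \<open>
  Start from any normal form. As long as its last weight exceeds \<open>N\<close>, the vanishing of the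
  corresponding coefficient of the image kills the last summand, which can be dropped.
\<close>

lemma degree_le_imp_span:
  assumes "\<And>t. t > N \<Longrightarrow> Polynomial.coeff (\<chi> a) t = 0"
  shows "a \<in> span_upto N"
proof -
  have "a \<in> span_upto M \<Longrightarrow> a \<in> span_upto N" for M
  proof (induction M)
    case 0
    then show ?case by (rule span_mono[rotated]) simp
  next
    case (Suc M)
    show ?case
    proof (cases "Suc M \<le> N")
      case True
      then show ?thesis using Suc.prems span_mono by blast
    next
      case False
      obtain c where "a - (\<Sum>t\<le>Suc M. h (c t) * nmon t) \<in> I"
        using Suc.prems unfolding span_upto_def by blast
      then have "a - (\<Sum>t<Suc M. h (c t) * nmon t) \<in> I"
        using False by (intro top_coeff_0_imp_span_pred assms) auto
      then have "a \<in> span_upto M" unfolding span_upto_def lessThan_Suc_atMost by blast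
      then show ?thesis by (rule Suc.IH)
    qed
  qed
  then show ?thesis using spanned_UNIV unfolding spanned_def by blast
qed

text \<open>
  The same descent, carried through to the last summand, shows that the ideal is the full kernel;
  so the quotient by \<open>I\<close> embeds into \<open>K[S]\<close>.
\<close>

lemma chi_eq_0_iff: "\<chi> a = 0 \<longleftrightarrow> a \<in> I"
proof
  assume 0: "\<chi> a = 0"
  then have "a \<in> span_upto 0" by (intro degree_le_imp_span) simp
  then obtain c where "a - (\<Sum>t\<le>0. h (c t) * nmon t) \<in> I" unfolding span_upto_def by blast
  then have "a - (\<Sum>t<0. h (c t) * nmon t) \<in> I" by (rule top_coeff_0_imp_span_pred) (simp add: 0)
  then show "a \<in> I" by simp
qed (rule chi_I)

lemma chi_eq_iff: "\<chi> a = \<chi> a' \<longleftrightarrow> a - a' \<in> I"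
  using chi_eq_0_iff[of "a - a'"] by simp

text \<open>
  This determines the homogeneous part of degree \<open>N\<close> of the associated graded ring.
\<close>

lemma leading_coeffs:
  "{Polynomial.coeff (\<chi> a) N |a. \<forall>t>N. Polynomial.coeff (\<chi> a) t = 0} = range (\<lambda>c. \<iota> c * \<xi> N)"
proof (intro equalityI subsetI)
  fix v assume "v \<in> {Polynomial.coeff (\<chi> a) N |a. \<forall>t>N. Polynomial.coeff (\<chi> a) t = 0}"
  then obtain a where a: "v = Polynomial.coeff (\<chi> a) N" "\<forall>t>N. Polynomial.coeff (\<chi> a) t = 0" by blast
  then have "a \<in> span_upto N" by (intro degree_le_imp_span) blast
  then obtain c where "a - (\<Sum>t\<le>N. h (c t) * nmon t) \<in> I" unfolding span_upto_def by blast
  then have "v = \<iota> (c N) * \<xi> N" using a(1) chi_cong coeff_chi_sum(1) by metis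
  then show "v \<in> range (\<lambda>c. \<iota> c * \<xi> N)" by blast
next
  fix v assume "v \<in> range (\<lambda>c. \<iota> c * \<xi> N)"
  then obtain c where "v = \<iota> c * \<xi> N" by blast
  moreover have "\<chi> (h c * nmon N) = Polynomial.smult (\<iota> c) (\<chi> (nmon N))" by (simp add: chi_h)
  ultimately show "v \<in> {Polynomial.coeff (\<chi> a) N |a. \<forall>t>N. Polynomial.coeff (\<chi> a) t = 0}"
    using chi_nmon[of N] by (auto intro!: exI[of _ "h c * nmon N"] coeff_eq_0)
qed

end

section \<open>Ring records presented by a type\<close>

text \<open>
  The rings of the theorem are records with a carrier, whereas the computations take place in
  types of class \<^class>\<open>comm_ring_1\<close>. A surjective homomorphism from such a type carries every
  computation over, as each element of the carrier then has a representative in the type.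
\<close>

locale type_epi = ring H for H :: "('h, 'x) ring_scheme" (structure) +
  fixes \<eta> :: "'b::comm_ring_1 \<Rightarrow> 'h"
  assumes surj: "range \<eta> = carrier H"
    and hom_1: "\<eta> 1 = \<one>"
    and hom_add: "\<eta> (a + b) = \<eta> a \<oplus> \<eta> b"
    and hom_mult: "\<eta> (a * b) = \<eta> a \<otimes> \<eta> b"
begin

lemma hom_closed [simp]: "\<eta> a \<in> carrier H"
  using surj by auto

lemma hom_0: "\<eta> 0 = \<zero>"
  using hom_add[of 0 0] add.l_cancel_one'[of "\<eta> 0" "\<eta> 0"] by simp

lemma hom_uminus: "\<eta> (- a) = \<ominus> \<eta> a"
  by (rule sym, rule minus_equality) (simp_all add: hom_0 flip: hom_add)

lemma hom_diff: "\<eta> (a - b) = \<eta> a \<ominus> \<eta> b"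
  using hom_add[of a "- b"] by (simp add: hom_uminus a_minus_def)

lemma hom_power: "\<eta> (a ^ N) = \<eta> a [^] N"
  by (induction N) (simp_all add: hom_1 power_Suc2 hom_mult del: power_Suc)

lemma hom_sum: "finite T \<Longrightarrow> \<eta> (sum u T) = (\<Oplus>i\<in>T. \<eta> (u i))"
  by (induction T rule: finite_induct) (simp_all add: hom_0 hom_add)

lemma generated_image:
  assumes "ring_map k"
  shows "generate_ring H (range (\<lambda>c. \<eta> (k [:c:])) \<union> {\<eta> (k [:0, 1:])}) = range (\<lambda>p. \<eta> (k p))"
    (is "?L = ?R")
proof (intro equalityI subsetI)
  interpret k: ring_map k by fact
  fix v assume "v \<in> ?L"
  then show "v \<in> ?R"
  proof (induction rule: generate_ring.induct)
    case one
    show ?case by (rule range_eqI[of _ _ 1]) (simp add: hom_1)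
  next
    case (a_inv v)
    then obtain p where "v = \<eta> (k p)" by blast
    then show ?case by (intro range_eqI[of _ _ "- p"]) (simp add: hom_uminus)
  next
    case (eng_add v w)
    then obtain p q where "v = \<eta> (k p)" "w = \<eta> (k q)" by blast
    then show ?case by (intro range_eqI[of _ _ "p + q"]) (simp add: hom_add)
  next
    case (eng_mult v w)
    then obtain p q where "v = \<eta> (k p)" "w = \<eta> (k q)" by blast
    then show ?case by (intro range_eqI[of _ _ "p * q"]) (simp add: hom_mult)
  qed blast
next
  interpret k: ring_map k by fact
  fix v assume "v \<in> ?R"
  then obtain p where v: "v = \<eta> (k p)" by blast
  show "v \<in> ?L" unfolding v
    by (induction p rule: poly_generated_induct)
       (auto simp: hom_add hom_mult intro: generate_ring.intros)
qed

end

lemma ring_of_type_simps [simp]: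
  "carrier ring_of_type_algebra = UNIV" "\<one>\<^bsub>ring_of_type_algebra\<^esub> = 1"
  "\<zero>\<^bsub>ring_of_type_algebra\<^esub> = 0"
  "a \<oplus>\<^bsub>ring_of_type_algebra\<^esub> b = a + b" "a \<otimes>\<^bsub>ring_of_type_algebra\<^esub> b = a * b"
  by (simp_all add: ring_of_type_algebra_def)

lemma type_epi_id: "type_epi ring_of_type_algebra (\<lambda>a::'b::comm_ring_1. a)"
  by (intro type_epi.intro type_epi_axioms.intro) (auto intro: ring_from_type_algebra)

lemma type_epi_Quot:
  fixes J :: "'b::comm_ring_1 set"
  assumes "ideal J ring_of_type_algebra"
  shows "type_epi (ring_of_type_algebra Quot J) (\<lambda>p. J +>\<^bsub>ring_of_type_algebra\<^esub> p)"
proof -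
  interpret ideal J "ring_of_type_algebra :: 'b ring" by fact
  note hom = rcos_ring_hom
  show ?thesis
  proof (intro type_epi.intro type_epi_axioms.intro)
    show "range (\<lambda>p. J +>\<^bsub>ring_of_type_algebra\<^esub> p) = carrier (ring_of_type_algebra Quot J)"
      by (auto simp: FactRing_def A_RCOSETS_def' a_r_coset_def')
  qed (use quotient_is_ring ring_hom_add[OF hom] ring_hom_mult[OF hom] ring_hom_one[OF hom] in simp_all)
qed

lemma Quot_coset_eq_iff:
  fixes J :: "'b::comm_ring_1 set"
  assumes "ideal J ring_of_type_algebra"
  shows "J +>\<^bsub>ring_of_type_algebra\<^esub> p = J +>\<^bsub>ring_of_type_algebra\<^esub> q \<longleftrightarrow> p - q \<in> J"
proof -
  interpret ideal J "ring_of_type_algebra :: 'b ring" by fact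
  interpret E: type_epi "ring_of_type_algebra :: 'b ring" "\<lambda>a. a" by (rule type_epi_id)
  show ?thesis
    using quotient_eq_iff_same_a_r_cos[OF assms, of p q] E.hom_diff[of p q] by simp
qed

section \<open>The associated graded ring of an embedded derivation\<close>

text \<open>
  Let \<open>R\<close> be embedded in \<open>K[S]\<close> in such a way that \<open>D\<close> becomes \<open>u d/dS\<close>. Then the filtration
  of \<open>D\<close> is the filtration by degree in \<open>S\<close>, a class of degree \<open>i\<close> is known by its coefficient at
  \<open>S\<^sup>i\<close>, and the associated graded ring is a graded subring of \<open>K[S]\<close> again.
\<close>

locale embedded_derivation = cring R for R :: "('r, 'x) ring_scheme" (structure) +
  fixes \<psi> :: "'r \<Rightarrow> 'K::field_char_0 poly" and D :: "'r \<Rightarrow> 'r" and u :: 'K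
  assumes psi_1: "\<psi> \<one> = 1"
    and psi_add: "a \<in> carrier R \<Longrightarrow> b \<in> carrier R \<Longrightarrow> \<psi> (a \<oplus> b) = \<psi> a + \<psi> b"
    and psi_mult: "a \<in> carrier R \<Longrightarrow> b \<in> carrier R \<Longrightarrow> \<psi> (a \<otimes> b) = \<psi> a * \<psi> b"
    and psi_inj: "inj_on \<psi> (carrier R)"
    and D_closed: "a \<in> carrier R \<Longrightarrow> D a \<in> carrier R"
    and psi_D: "a \<in> carrier R \<Longrightarrow> \<psi> (D a) = Polynomial.smult u (pderiv (\<psi> a))"
    and u_nonzero: "u \<noteq> 0"
begin

lemma psi_0: "\<psi> \<zero> = 0"
  using psi_add[of \<zero> \<zero>] by simp

lemma psi_eq_0_iff: "a \<in> carrier R \<Longrightarrow> \<psi> a = 0 \<longleftrightarrow> a = \<zero>"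
  using psi_inj psi_0 by (metis inj_onD zero_closed)

lemma psi_uminus: "a \<in> carrier R \<Longrightarrow> \<psi> (\<ominus> a) = - \<psi> a"
  using psi_add[of "\<ominus> a" a] by (simp add: l_neg psi_0 eq_neg_iff_add_eq_0)

lemma psi_minus: "a \<in> carrier R \<Longrightarrow> b \<in> carrier R \<Longrightarrow> \<psi> (a \<ominus> b) = \<psi> a - \<psi> b"
  by (simp add: a_minus_def psi_add psi_uminus)

text \<open>
  Characteristic zero is essential here: \<open>u d/dS\<close> multiplies the coefficient of \<open>S\<^sup>t\<^sup>+\<^sup>1\<close> by
  \<open>u (t + 1)\<close>, which is not zero, so each application lowers a positive degree by exactly one.
\<close>

lemma iterated_derivative_eq_0_iff:
  "((\<lambda>q. Polynomial.smult u (pderiv q)) ^^ N) q = 0 \<longleftrightarrow> (\<forall>t\<ge>N. Polynomial.coeff q t = 0)"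
proof (induction N arbitrary: q)
  case 0
  show ?case by (auto simp: poly_eq_iff)
next
  case (Suc N)
  have "((\<lambda>q. Polynomial.smult u (pderiv q)) ^^ Suc N) q
      = ((\<lambda>q. Polynomial.smult u (pderiv q)) ^^ N) (Polynomial.smult u (pderiv q))"
    by (simp only: funpow_Suc_right o_apply)
  also have "\<dots> = 0 \<longleftrightarrow> (\<forall>t\<ge>N. Polynomial.coeff q (Suc t) = 0)"
    using u_nonzero by (simp add: Suc.IH coeff_pderiv del: of_nat_Suc)
  also have "\<dots> \<longleftrightarrow> (\<forall>t\<ge>Suc N. Polynomial.coeff q t = 0)"
    by (metis Suc_le_D Suc_le_mono)
  finally show ?case .
qed

lemma filtr_eq: "filtr R D i = {a \<in> carrier R. \<forall>t. int t > i \<longrightarrow> Polynomial.coeff (\<psi> a) t = 0}"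
proof -
  have *: "(D ^^ N) a \<in> carrier R \<and> \<psi> ((D ^^ N) a) = ((\<lambda>q. Polynomial.smult u (pderiv q)) ^^ N) (\<psi> a)"
    if "a \<in> carrier R" for a N
    using that by (induction N) (simp_all add: D_closed psi_D)
  have "(D ^^ N) a = \<zero> \<longleftrightarrow> (\<forall>t\<ge>N. Polynomial.coeff (\<psi> a) t = 0)" if "a \<in> carrier R" for a N
    using psi_eq_0_iff[of "(D ^^ N) a"] *[OF that, of N] iterated_derivative_eq_0_iff by simp
  moreover have "nat (i + 1) \<le> t \<longleftrightarrow> i < int t" for t by linarith
  ultimately show ?thesis unfolding filtr_def by auto
qed

lemma filtr_nat: "filtr R D (int i) = {a \<in> carrier R. \<forall>t>i. Polynomial.coeff (\<psi> a) t = 0}"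
  by (simp add: filtr_eq)

text \<open>
  Either empty or a coset modulo the elements of degree below \<open>i\<close>; thus \<open>c\<close> serves as a name for
  the coset, and the operations on cosets become operations on the names.
\<close>

definition lead_class :: "nat \<Rightarrow> 'K \<Rightarrow> 'r set" where
  "lead_class i c = {a \<in> carrier R. (\<forall>t>i. Polynomial.coeff (\<psi> a) t = 0) \<and> Polynomial.coeff (\<psi> a) i = c}"

text \<open>
  The names \<open>c\<close> whose class is not empty; they form an additive group isomorphic to the \<open>i\<close>-th
  graded part.
\<close>

definition lead_values :: "nat \<Rightarrow> 'K set" where
  "lead_values i = {Polynomial.coeff (\<psi> a) i |a. a \<in> carrier R \<and> (\<forall>t>i. Polynomial.coeff (\<psi> a) t = 0)}"

lemma lead_values_iff: "c \<in> lead_values i \<longleftrightarrow> lead_class i c \<noteq> {}"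
  unfolding lead_values_def lead_class_def by auto

lemma lead_class_inj: "lead_class i c = lead_class i c' \<Longrightarrow> c \<in> lead_values i \<Longrightarrow> c = c'"
proof -
  assume eq: "lead_class i c = lead_class i c'" and "c \<in> lead_values i"
  then obtain a where "a \<in> lead_class i c" using lead_values_iff by blast
  with eq have "a \<in> lead_class i c" "a \<in> lead_class i c'" by auto
  then show ?thesis by (simp add: lead_class_def)
qed

lemma filtr_pred: "filtr R D (int i - 1) = lead_class i 0"
proof -
  have "int i - 1 < int t \<longleftrightarrow> t = i \<or> i < t" for t by linarith
  then show ?thesis unfolding filtr_eq lead_class_def by auto
qed

lemma lead_class_add: "a \<in> lead_class i c \<Longrightarrow> b \<in> lead_class i c' \<Longrightarrow> a \<oplus> b \<in> lead_class i (c + c')"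
  unfolding lead_class_def by (auto simp: psi_add)

lemma lead_class_uminus: "a \<in> lead_class i c \<Longrightarrow> \<ominus> a \<in> lead_class i (- c)"
  unfolding lead_class_def by (auto simp: psi_uminus)

lemma lead_class_minus: "a \<in> lead_class i c \<Longrightarrow> b \<in> lead_class i c' \<Longrightarrow> a \<ominus> b \<in> lead_class i (c - c')"
  unfolding lead_class_def by (auto simp: psi_minus)

lemma lead_class_mult:
  assumes "a \<in> lead_class i c" "b \<in> lead_class j c'"
  shows "a \<otimes> b \<in> lead_class (i + j) (c * c')"
proof -
  have a: "a \<in> carrier R" "\<And>t. t > i \<Longrightarrow> Polynomial.coeff (\<psi> a) t = 0" "Polynomial.coeff (\<psi> a) i = c"
    and b: "b \<in> carrier R" "\<And>t. t > j \<Longrightarrow> Polynomial.coeff (\<psi> b) t = 0" "Polynomial.coeff (\<psi> b) j = c'"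
    using assms by (auto simp: lead_class_def)
  have "Polynomial.coeff (\<psi> a * \<psi> b) t = 0" if "t > i + j" for t
    unfolding Polynomial.coeff_mult
  proof (intro sum.neutral ballI)
    fix r assume "r \<in> {..t}"
    then show "Polynomial.coeff (\<psi> a) r * Polynomial.coeff (\<psi> b) (t - r) = 0"
      using a(2)[of r] b(2)[of "t - r"] that by (cases "r > i") auto
  qed
  moreover have "Polynomial.coeff (\<psi> a * \<psi> b) (i + j)
      = (\<Sum>r\<in>{i}. Polynomial.coeff (\<psi> a) r * Polynomial.coeff (\<psi> b) (i + j - r))"
    unfolding Polynomial.coeff_mult
  proof (intro sum.mono_neutral_right ballI)
    fix r assume "r \<in> {..i + j} - {i}"
    then show "Polynomial.coeff (\<psi> a) r * Polynomial.coeff (\<psi> b) (i + j - r) = 0"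
      using a(2)[of r] b(2)[of "i + j - r"] by (cases "r > i") auto
  qed auto
  ultimately show ?thesis using a b by (simp add: lead_class_def psi_mult)
qed

lemma lead_values_add: "c \<in> lead_values i \<Longrightarrow> c' \<in> lead_values i \<Longrightarrow> c + c' \<in> lead_values i"
  unfolding lead_values_iff using lead_class_add by blast

lemma lead_values_uminus: "c \<in> lead_values i \<Longrightarrow> - c \<in> lead_values i"
  unfolding lead_values_iff using lead_class_uminus by blast

lemma lead_values_mult: "c \<in> lead_values i \<Longrightarrow> c' \<in> lead_values j \<Longrightarrow> c * c' \<in> lead_values (i + j)"
  unfolding lead_values_iff using lead_class_mult by blast

lemma lead_values_0: "0 \<in> lead_values i"
  unfolding lead_values_iff lead_class_def using psi_0 by (auto intro!: exI[of _ "\<zero>"])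

lemma lead_values_sum: "(\<And>t. t \<in> T \<Longrightarrow> c t \<in> lead_values i) \<Longrightarrow> sum c T \<in> lead_values i"
  by (induction T rule: infinite_finite_induct) (auto simp: lead_values_0 lead_values_add)

lemma lead_class_carrier: "a \<in> lead_class i c \<Longrightarrow> a \<in> carrier R"
  by (simp add: lead_class_def)

lemma lead_class_coset: "a \<in> lead_class i c \<Longrightarrow> lead_class i 0 +> a = lead_class i c"
proof (intro equalityI subsetI)
  assume a: "a \<in> lead_class i c"
  fix b assume "b \<in> lead_class i 0 +> a"
  then show "b \<in> lead_class i c" using lead_class_add[OF _ a, of _ 0] by (auto simp: a_r_coset_def')
next
  assume a: "a \<in> lead_class i c"
  fix b assume b: "b \<in> lead_class i c"
  have "b \<ominus> a \<in> lead_class i 0" using lead_class_minus[OF b a] by simp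
  moreover have "b = (b \<ominus> a) \<oplus> a"
    using lead_class_carrier[OF a] lead_class_carrier[OF b] by (simp add: a_minus_def a_assoc l_neg)
  ultimately show "b \<in> lead_class i 0 +> a" by (auto simp: a_r_coset_def')
qed

text \<open>
  Only one of the two classes has to be nonempty: an element of the right-hand side minus a fixed
  element of the first class lies in the second.
\<close>

lemma lead_class_set_add:
  assumes "c \<in> lead_values i"
  shows "lead_class i c <+>\<^bsub>R\<^esub> lead_class i c' = lead_class i (c + c')"
proof (intro equalityI subsetI)
  fix b assume "b \<in> lead_class i c <+>\<^bsub>R\<^esub> lead_class i c'"
  then show "b \<in> lead_class i (c + c')" using lead_class_add by (auto simp: set_add_def')
next
  fix b assume b: "b \<in> lead_class i (c + c')"
  obtain a where a: "a \<in> lead_class i c" using assms lead_values_iff by blast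
  have "b \<ominus> a \<in> lead_class i c'" using lead_class_minus[OF b a] by simp
  moreover have "b = a \<oplus> (b \<ominus> a)"
    using lead_class_carrier[OF a] lead_class_carrier[OF b] by (simp add: a_minus_def a_comm[of a] a_assoc l_neg)
  ultimately show "b \<in> lead_class i c <+>\<^bsub>R\<^esub> lead_class i c'" using a by (auto simp: set_add_def')
qed

lemma lead_class_rcoset_mult:
  assumes "c \<in> lead_values i" "c' \<in> lead_values j"
  shows "rcoset_mult R (lead_class (i + j) 0) (lead_class i c) (lead_class j c') = lead_class (i + j) (c * c')"
proof -
  have "lead_class (i + j) 0 +> a \<otimes> b = lead_class (i + j) (c * c')" if "a \<in> lead_class i c" "b \<in> lead_class j c'" for a b
    by (rule lead_class_coset[OF lead_class_mult[OF that]])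
  moreover have "lead_class i c \<noteq> {}" "lead_class j c' \<noteq> {}" using assms lead_values_iff by auto
  ultimately show ?thesis unfolding rcoset_mult_def by auto
qed

lemma gr_part_carrier: "carrier (gr_part R D i) = lead_class i ` lead_values i"
proof -
  have "lead_class i 0 +>\<^bsub>R\<lparr>carrier := filtr R D (int i)\<rparr>\<^esub> a = lead_class i (Polynomial.coeff (\<psi> a) i)"
    if "a \<in> filtr R D (int i)" for a
    using lead_class_coset[of a i "Polynomial.coeff (\<psi> a) i"] that
    by (simp add: filtr_nat lead_class_def a_r_coset_def')
  then have "carrier (gr_part R D i) = (\<lambda>a. lead_class i (Polynomial.coeff (\<psi> a) i)) ` filtr R D (int i)"
    by (auto simp: gr_part_def A_FactGroup_def' A_RCOSETS_def' a_r_coset_def' filtr_pred image_def)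
  then show ?thesis by (auto simp: filtr_nat lead_values_def)
qed

lemma gr_part_one: "\<one>\<^bsub>gr_part R D i\<^esub> = lead_class i 0"
  by (simp add: gr_part_def A_FactGroup_def' filtr_pred)

lemma gr_part_mult: "c \<in> lead_values i \<Longrightarrow> lead_class i c \<otimes>\<^bsub>gr_part R D i\<^esub> lead_class i c' = lead_class i (c + c')"
  using lead_class_set_add[of c i c'] by (simp add: gr_part_def A_FactGroup_def' set_add_def')

lemma gr_part_group: "comm_group (gr_part R D i)"
proof (rule comm_groupI)
  fix v assume "v \<in> carrier (gr_part R D i)"
  then obtain c where "v = lead_class i c" "c \<in> lead_values i" by (auto simp: gr_part_carrier)
  then show "\<exists>w\<in>carrier (gr_part R D i). w \<otimes>\<^bsub>gr_part R D i\<^esub> v = \<one>\<^bsub>gr_part R D i\<^esub>"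
    by (auto intro!: bexI[of _ "- c"] simp: gr_part_carrier gr_part_one gr_part_mult lead_values_uminus)
qed (auto simp: gr_part_carrier gr_part_one gr_part_mult lead_values_add lead_values_0 add_ac)

lemma gr_part_finprod:
  assumes "finite T" "\<And>t. t \<in> T \<Longrightarrow> c t \<in> lead_values i"
  shows "finprod (gr_part R D i) (\<lambda>t. lead_class i (c t)) T = lead_class i (sum c T)"
proof -
  interpret comm_group "gr_part R D i" by (rule gr_part_group)
  show ?thesis using assms
    by (induction T rule: finite_induct)
       (auto simp: gr_part_one gr_part_carrier gr_part_mult lead_values_sum Pi_iff)
qed

text \<open>
  The model of the associated graded ring inside \<open>K[S]\<close>, and the map \<open>to_Gr\<close> that reads the
  coefficient at \<open>S\<^sup>i\<close> as a class of degree \<open>i\<close>.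
\<close>

definition graded_subring :: "'K poly set" where
  "graded_subring = {p. \<forall>i. Polynomial.coeff p i \<in> lead_values i}"

definition to_Gr :: "'K poly \<Rightarrow> nat \<Rightarrow> 'r set" where
  "to_Gr p = (\<lambda>i. lead_class i (Polynomial.coeff p i))"

lemma to_Gr_inj: "inj_on to_Gr graded_subring"
proof (rule inj_onI)
  fix p q assume "p \<in> graded_subring" "to_Gr p = to_Gr q"
  then have "Polynomial.coeff p i = Polynomial.coeff q i" for i
    by (intro lead_class_inj[of i]) (auto simp: to_Gr_def graded_subring_def fun_eq_iff)
  then show "p = q" by (simp add: poly_eq_iff)
qed

lemma Gr_carrier: "carrier (Gr R D) = to_Gr ` graded_subring"
proof -
  have G: "group (gr_part R D i)" for i
    using gr_part_group comm_group_def by blast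
  have "carrier (Gr R D) = {v. (\<forall>i. v i \<in> lead_class i ` lead_values i) \<and> finite {i. v i \<noteq> lead_class i 0}}"
    by (auto simp: Gr_def carrier_sum_group[OF G] gr_part_carrier gr_part_one PiE_UNIV_domain)
  also have "\<dots> = to_Gr ` graded_subring"
  proof (intro equalityI subsetI)
    fix v assume "v \<in> to_Gr ` graded_subring"
    then obtain p where p: "v = to_Gr p" "\<And>i. Polynomial.coeff p i \<in> lead_values i"
      by (auto simp: graded_subring_def)
    have "{i. v i \<noteq> lead_class i 0} \<subseteq> {..Polynomial.degree p}"
    proof
      fix i assume "i \<in> {i. v i \<noteq> lead_class i 0}"
      then have "Polynomial.coeff p i \<noteq> 0" by (auto simp: p to_Gr_def)
      then show "i \<in> {..Polynomial.degree p}" by (simp add: le_degree)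
    qed
    then show "v \<in> {v. (\<forall>i. v i \<in> lead_class i ` lead_values i) \<and> finite {i. v i \<noteq> lead_class i 0}}"
      using p by (auto simp: to_Gr_def intro: finite_subset)
  next
    fix v assume v: "v \<in> {v. (\<forall>i. v i \<in> lead_class i ` lead_values i) \<and> finite {i. v i \<noteq> lead_class i 0}}"
    then have "\<forall>i. \<exists>c. c \<in> lead_values i \<and> v i = lead_class i c" by auto
    then obtain c where c: "\<And>i. c i \<in> lead_values i" "\<And>i. v i = lead_class i (c i)" by metis
    have "v i = lead_class i 0 \<longleftrightarrow> c i = 0" for i using c(2)[of i] lead_class_inj[OF _ c(1)[of i], of 0] by auto
    then have "{i. c i \<noteq> 0} = {i. v i \<noteq> lead_class i 0}" by simp
    then have "finite {i. c i \<noteq> 0}" using v by simp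
    then have "Polynomial.coeff (Abs_poly c) = c"
      by (intro Abs_poly_inverse) (simp add: eventually_cofinite)
    then show "v \<in> to_Gr ` graded_subring"
      using c by (intro image_eqI[of _ _ "Abs_poly c"]) (auto simp: to_Gr_def graded_subring_def)
  qed
  finally show ?thesis .
qed

lemma to_Gr_add: "p \<in> graded_subring \<Longrightarrow> to_Gr p \<oplus>\<^bsub>Gr R D\<^esub> to_Gr q = to_Gr (p + q)"
  by (auto simp: to_Gr_def Gr_def graded_subring_def gr_part_mult)

text \<open>
  Multiplication of polynomials is the convolution of coefficients, and leading coefficients
  multiply. This is the product of the associated graded ring.
\<close>

lemma to_Gr_mult:
  assumes "p \<in> graded_subring" "q \<in> graded_subring"
  shows "to_Gr p \<otimes>\<^bsub>Gr R D\<^esub> to_Gr q = to_Gr (p * q)"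
proof
  fix N
  have pq: "Polynomial.coeff p i \<in> lead_values i" "Polynomial.coeff q i \<in> lead_values i" for i
    using assms by (auto simp: graded_subring_def)
  have eq: "rcoset_mult R (lead_class N 0) (lead_class i (Polynomial.coeff p i)) (lead_class (N - i) (Polynomial.coeff q (N - i)))
      = lead_class N (Polynomial.coeff p i * Polynomial.coeff q (N - i))"
    and mem: "Polynomial.coeff p i * Polynomial.coeff q (N - i) \<in> lead_values N" if "i \<in> {..N}" for i
    using lead_class_rcoset_mult[OF pq(1)[of i] pq(2)[of "N - i"]] lead_values_mult[OF pq(1)[of i] pq(2)[of "N - i"]] that
    by simp_all
  have "(to_Gr p \<otimes>\<^bsub>Gr R D\<^esub> to_Gr q) N = finprod (gr_part R D N)
      (\<lambda>i. rcoset_mult R (lead_class N 0) (lead_class i (Polynomial.coeff p i)) (lead_class (N - i) (Polynomial.coeff q (N - i)))) {..N}"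
    by (simp add: Gr_def to_Gr_def filtr_pred)
  also have "\<dots> = finprod (gr_part R D N)
      (\<lambda>i. lead_class N (Polynomial.coeff p i * Polynomial.coeff q (N - i))) {..N}"
  proof -
    interpret comm_group "gr_part R D N" by (rule gr_part_group)
    show ?thesis
      by (rule finprod_cong') (use eq mem in \<open>auto simp: gr_part_carrier Pi_iff\<close>)
  qed
  also have "\<dots> = lead_class N (\<Sum>i\<le>N. Polynomial.coeff p i * Polynomial.coeff q (N - i))"
    using mem by (intro gr_part_finprod) auto
  finally show "(to_Gr p \<otimes>\<^bsub>Gr R D\<^esub> to_Gr q) N = to_Gr (p * q) N"
    by (simp add: to_Gr_def Polynomial.coeff_mult)
qed

lemma to_Gr_0: "to_Gr 0 = \<zero>\<^bsub>Gr R D\<^esub>"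
  by (auto simp: to_Gr_def Gr_def gr_part_one)

lemma gr_class_eq:
  assumes "a \<in> filtr R D (int i)"
  shows "gr_class R D i a = to_Gr (Polynomial.monom (Polynomial.coeff (\<psi> a) i) i)"
  using assms lead_class_coset[of a i "Polynomial.coeff (\<psi> a) i"]
  by (auto simp: gr_class_def to_Gr_def fun_eq_iff filtr_pred gr_part_one filtr_nat lead_class_def)

lemma to_Gr_1: "to_Gr 1 = \<one>\<^bsub>Gr R D\<^esub>"
proof -
  have "\<one> \<in> filtr R D (int 0)" unfolding filtr_nat by (auto simp: psi_1)
  from gr_class_eq[OF this] show ?thesis by (simp add: Gr_def psi_1 Polynomial.monom_0 one_pCons)
qed

lemma gr_eq:
  assumes "a \<in> carrier R"
  shows "gr R D a = to_Gr (Polynomial.monom (lead_coeff (\<psi> a)) (Polynomial.degree (\<psi> a)))"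
proof -
  have *: "a \<in> filtr R D (int i) \<longleftrightarrow> Polynomial.degree (\<psi> a) \<le> i" for i
    using assms degree_le[of i "\<psi> a"] coeff_eq_0[of "\<psi> a"] by (auto simp: filtr_nat)
  have "(LEAST i. a \<in> filtr R D (int i)) = Polynomial.degree (\<psi> a)"
    unfolding * by (rule Least_equality) auto
  then show ?thesis using gr_class_eq[of a "Polynomial.degree (\<psi> a)"] * by (simp add: gr_def)
qed

lemma Gr_piece_eq: "Gr_piece R D i = (\<lambda>c. to_Gr (Polynomial.monom c i)) ` lead_values i"
proof (intro equalityI subsetI)
  fix v assume "v \<in> Gr_piece R D i"
  then obtain p where p: "v = to_Gr p" "p \<in> graded_subring" "\<And>j. j \<noteq> i \<Longrightarrow> v j = lead_class j 0"
    by (auto simp: Gr_piece_def Gr_carrier gr_part_one)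
  have "Polynomial.coeff p j = 0" if "j \<noteq> i" for j
    using p(3)[OF that] p(2) by (intro lead_class_inj[of j]) (auto simp: p(1) to_Gr_def graded_subring_def)
  then have "p = Polynomial.monom (Polynomial.coeff p i) i" by (auto simp: poly_eq_iff)
  then show "v \<in> (\<lambda>c. to_Gr (Polynomial.monom c i)) ` lead_values i"
    using p(1,2) by (intro image_eqI[of _ _ "Polynomial.coeff p i"]) (auto simp: graded_subring_def)
next
  fix v assume "v \<in> (\<lambda>c. to_Gr (Polynomial.monom c i)) ` lead_values i"
  then obtain c where c: "v = to_Gr (Polynomial.monom c i)" "c \<in> lead_values i" by blast
  have "Polynomial.monom c i \<in> graded_subring" using c lead_values_0 by (auto simp: graded_subring_def)
  then show "v \<in> Gr_piece R D i"
    using c by (auto simp: Gr_piece_def Gr_carrier gr_part_one) (auto simp: to_Gr_def)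
qed

text \<open>
  As an image of a ring under a homomorphism, the associated graded ring satisfies the ring axioms;
  they need not be checked on families of cosets.
\<close>

lemma Gr_type_epi:
  assumes "ring_map \<theta>" "range \<theta> = graded_subring"
  shows "type_epi (Gr R D) (\<lambda>p. to_Gr (\<theta> p))"
proof -
  interpret \<theta>: ring_map \<theta> by fact
  have mem: "\<theta> p \<in> graded_subring" for p using assms(2) by auto
  have c: "range (\<lambda>p. to_Gr (\<theta> p)) = carrier (Gr R D)"
    unfolding Gr_carrier assms(2)[symmetric] by auto
  have "(\<lambda>p. to_Gr (\<theta> p)) \<in> ring_hom ring_of_type_algebra (Gr R D)"
    by (rule ring_hom_memI) (auto simp: to_Gr_add to_Gr_mult mem to_Gr_1 Gr_carrier)
  then have "ring (Gr R D\<lparr>carrier := range (\<lambda>p. to_Gr (\<theta> p)), zero := to_Gr (\<theta> 0)\<rparr>)"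
    using ring.ring_hom_imp_img_ring[OF ring_from_type_algebra] by fastforce
  then have "ring (Gr R D)" unfolding c by (simp add: to_Gr_0)
  then show ?thesis
    by (intro type_epi.intro type_epi_axioms.intro)
       (simp_all add: c to_Gr_1 to_Gr_add to_Gr_mult mem)
qed

end

section \<open>Evaluation and ideals in polynomial rings\<close>

lemma subst_compose:
  assumes "ring_map h" "ring_map k"
  shows "k (subst h b q) = subst (\<lambda>c. k (h c)) (k b) q"
proof -
  interpret h: ring_map h by fact
  interpret k: ring_map k by fact
  interpret kh: ring_map "\<lambda>c. k (h c)" by (rule ring_map_compose) fact+
  show ?thesis by (induction q) simp_all
qed

lemma subst_const:
  assumes "ring_map h" shows "subst h b [:c:] = h c"
proof -
  interpret h: ring_map h by fact
  show ?thesis by simp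
qed

lemma subst_var:
  assumes "ring_map h" shows "subst h b [:0, 1:] = b"
proof -
  interpret h: ring_map h by fact
  show ?thesis by simp
qed

lemma subst_monic:
  assumes "ring_map h"
  shows "subst h b (Polynomial.monom 1 N + (\<Sum>t<N. Polynomial.monom (c t) t)) = b ^ N + (\<Sum>t<N. h (c t) * b ^ t)"
proof -
  interpret h: ring_map h by fact
  interpret s: ring_map "subst h b" by (rule h.ring_map_subst)
  show ?thesis by (simp add: s.map_sum h.subst_monom)
qed

lemma pderiv_subst:
  assumes "ring_map \<iota>"
  shows "pderiv (subst (\<lambda>c. [:\<iota> c:]) b q) = subst (\<lambda>c. [:\<iota> c:]) b (pderiv q) * pderiv b"
proof -
  interpret \<iota>: ring_map \<iota> by fact
  interpret h: ring_map "\<lambda>c. [:\<iota> c:]" by (rule ring_map_compose[OF assms ring_map_const])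
  show ?thesis
    by (induction q) (simp_all add: pderiv_add pderiv_mult pderiv_pCons h.subst_add algebra_simps)
qed

text \<open>
  The kernel of a homomorphism is an ideal, so it contains an ideal as soon as it contains a set of
  generators.
\<close>

lemma Idl_in_kernel:
  fixes \<chi> :: "'b::comm_ring_1 \<Rightarrow> 'c::comm_ring_1"
  assumes "ring_map \<chi>" "\<And>a. a \<in> T \<Longrightarrow> \<chi> a = 0" "p \<in> Idl\<^bsub>ring_of_type_algebra\<^esub> T"
  shows "\<chi> p = 0"
proof -
  interpret \<chi>: ring_map \<chi> by fact
  interpret id: type_epi "ring_of_type_algebra :: 'b ring" "\<lambda>a. a" by (rule type_epi_id)
  have "ideal {a. \<chi> a = 0} ring_of_type_algebra"
  proof (rule idealI)
    show "subgroup {a. \<chi> a = 0} (add_monoid ring_of_type_algebra)"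
    proof (rule id.add.subgroupI)
      show "\<ominus>\<^bsub>ring_of_type_algebra\<^esub> a \<in> {a. \<chi> a = 0}" if "a \<in> {a. \<chi> a = 0}" for a
        using that id.hom_uminus[of a] by (metis (mono_tags) \<chi>.map_minus mem_Collect_eq minus_zero)
    qed (auto intro!: exI[of _ 0])
  qed (auto intro: id.ring_axioms)
  then show ?thesis using id.genideal_minimal[of "{a. \<chi> a = 0}" T] assms(2,3) by auto
qed

lemma ideal_Idl: "ideal (Idl\<^bsub>ring_of_type_algebra\<^esub> (T :: 'b::comm_ring_1 set)) ring_of_type_algebra"
  by (rule ring.genideal_ideal[OF ring_from_type_algebra]) simp

lemma ideal_type_closed:
  assumes "ideal J (ring_of_type_algebra :: 'b::comm_ring_1 ring)"
  shows "0 \<in> J" "a \<in> J \<Longrightarrow> b \<in> J \<Longrightarrow> a + b \<in> J" "a \<in> J \<Longrightarrow> c * a \<in> J"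
proof -
  interpret ideal J "ring_of_type_algebra :: 'b ring" by fact
  show "0 \<in> J" "a \<in> J \<Longrightarrow> b \<in> J \<Longrightarrow> a + b \<in> J" "a \<in> J \<Longrightarrow> c * a \<in> J"
    using additive_subgroup.zero_closed[OF is_additive_subgroup] 
      additive_subgroup.a_closed[OF is_additive_subgroup, of a b] I_l_closed[of a c] by auto
qed

lemma in_Idl: "a \<in> T \<Longrightarrow> a \<in> Idl\<^bsub>ring_of_type_algebra\<^esub> (T :: 'b::comm_ring_1 set)"
  using ring.genideal_self[OF ring_from_type_algebra, of T] by auto

definition scal3 :: "'k::field poly \<Rightarrow> 'k poly poly poly" where "scal3 c = [:[:c:]:]"
definition scal4 :: "'k::field poly \<Rightarrow> 'k poly poly poly poly" where "scal4 c = [:[:[:c:]:]:]"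

lemma poly3_generated_induct:
  fixes p :: "'k::field poly poly poly"
  assumes gens: "\<And>c. T (scal3 c)" "T Y3" "T Z3"
    and add: "\<And>a b. T a \<Longrightarrow> T b \<Longrightarrow> T (a + b)" and mult: "\<And>a b. T a \<Longrightarrow> T b \<Longrightarrow> T (a * b)"
  shows "T p"
proof (induction p rule: poly_generated_induct)
  fix c :: "'k poly poly"
  show "T [:c:]"
  proof (induction c rule: poly_generated_induct)
    case (3 a b)
    then show ?case using add[of "[:a:]" "[:b:]"] by simp
  next
    case (4 a b)
    then show ?case using mult[of "[:a:]" "[:b:]"] by (simp add: mult.commute)
  qed (use gens in \<open>simp_all add: scal3_def Y3_def\<close>)
qed (use gens add mult in \<open>simp_all add: Z3_def\<close>)

lemma poly4_generated_induct:
  fixes p :: "'k::field poly poly poly poly"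
  assumes gens: "\<And>c. T (scal4 c)" "T Y4" "T Z4" "T S4"
    and add: "\<And>a b. T a \<Longrightarrow> T b \<Longrightarrow> T (a + b)" and mult: "\<And>a b. T a \<Longrightarrow> T b \<Longrightarrow> T (a * b)"
  shows "T p"
proof (induction p rule: poly_generated_induct)
  fix c :: "'k poly poly poly"
  show "T [:c:]"
  proof (induction c rule: poly3_generated_induct)
    case (4 a b)
    then show ?case using add[of "[:a:]" "[:b:]"] by simp
  next
    case (5 a b)
    then show ?case using mult[of "[:a:]" "[:b:]"] by (simp add: mult.commute)
  qed (use gens in \<open>simp_all add: scal4_def scal3_def Y4_def Z4_def\<close>)
qed (use gens add mult in \<open>simp_all add: S4_def\<close>)

lemma ring_map_scal3: "ring_map scal3"
  unfolding scal3_def by (rule ring_map_compose[OF ring_map_const ring_map_const])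

lemma ring_map_scal4: "ring_map scal4"
  unfolding scal4_def
  by (rule ring_map_compose[OF ring_map_const ring_map_compose[OF ring_map_const ring_map_const]])

lemma scal3_eq_sum: "(\<Sum>i\<le>Polynomial.degree c. C3 (Polynomial.coeff c i) * X3 ^ i) = scal3 c"
proof -
  interpret C: ring_map "C3 :: 'a::field \<Rightarrow> _"
    by unfold_locales (simp_all add: C3_def one_pCons)
  have step: "scal3 (pCons a p) = C3 a + X3 * scal3 p" for a :: 'a and p
    by (simp add: scal3_def X3_def C3_def)
  have "scal3 (0 :: 'a poly) = 0" by (simp add: scal3_def)
  then have "subst C3 X3 c = scal3 c"
    by (induction c) (simp_all add: step)
  then show ?thesis by (simp add: C.subst_eq_sum)
qed

lemma (in type_epi) eval2_eq:
  fixes \<eta>' :: "'k::field poly poly poly \<Rightarrow> 'h"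
  assumes "type_epi H \<eta>'"
  shows "eval2 H (\<lambda>c. \<eta>' (C3 c)) q (\<eta>' X3) (\<eta>' b) = \<eta>' (subst scal3 b q)"
proof -
  interpret \<eta>': type_epi H \<eta>' by fact
  interpret S: ring_map "scal3 :: 'k poly \<Rightarrow> _" by (rule ring_map_scal3)
  show ?thesis
    by (simp add: eval2_def S.subst_eq_sum \<eta>'.hom_sum \<eta>'.hom_mult \<eta>'.hom_power flip: scal3_eq_sum)
qed

lemma eval2_Pol3: "eval2 Pol3 C3 q X3 b = subst scal3 b (q :: 'k::field poly poly)"
proof -
  interpret id: type_epi "Pol3 :: 'k poly poly poly ring" "\<lambda>a. a" by (rule type_epi_id)
  show ?thesis using id.eval2_eq[OF type_epi_id, of q b] by simp
qed

section \<open>The two algebras inside the polynomial ring over Laurent series\<close>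

text \<open>
  A field of characteristic zero containing \<open>k[X]\<close>, in which \<open>X\<close> can be inverted.
\<close>

definition iota :: "'k::field_char_0 poly \<Rightarrow> 'k fls" where
  "iota c = fps_to_fls (fps_of_poly c)"

lemma ring_map_iota: "ring_map iota"
  by unfold_locales (simp_all add: iota_def fps_of_poly_add fps_of_poly_mult fls_times_fps_to_fls)

lemma inj_iota: "inj iota"
  by (rule injI) (simp add: iota_def fps_of_poly_eq_iff)

abbreviation cst :: "'k::field_char_0 poly \<Rightarrow> 'k fls poly" where "cst c \<equiv> [:iota c:]"

lemma ring_map_cst: "ring_map (\<lambda>c. cst c)"
  by (rule ring_map_compose[OF ring_map_iota ring_map_const])

locale surface_data =
  fixes n e d m :: nat and f g :: "nat \<Rightarrow> 'k::field_char_0 poly"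
  assumes d2: "d \<ge> 2" and m2: "m \<ge> 2"
begin

sublocale iota: ring_map iota by (rule ring_map_iota)
sublocale cst: ring_map "\<lambda>c. cst c" by (rule ring_map_cst)
sublocale scal3: ring_map "scal3 :: 'k poly \<Rightarrow> _" by (rule ring_map_scal3)
sublocale scal4: ring_map "scal4 :: 'k poly \<Rightarrow> _" by (rule ring_map_scal4)

abbreviation varX :: "'k poly" where "varX \<equiv> [:0, 1:]"

lemma iota_X_nonzero [simp]: "iota varX \<noteq> 0"
  using injD[OF inj_iota, of varX 0] by auto

lemma cst_power: "cst c ^ N = [:iota c ^ N:]"
  by (simp add: poly_const_pow)

definition P :: "'k poly poly" where "P = Polynomial.monom 1 d + (\<Sum>i<d. Polynomial.monom (f i) i)"
definition Q :: "'k poly poly" where "Q = Polynomial.monom 1 m + (\<Sum>j<m. Polynomial.monom (g j) j)"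

definition s3 :: "'k poly poly poly" where "s3 = subst scal3 Y3 Q - scal3 (varX ^ e) * Z3"

definition J :: "'k poly poly poly set" where "J = idealR n e P Q"

lemma scal3_X: "scal3 varX = X3" by (simp add: scal3_def X3_def)

lemma J_eq: "J = Idl\<^bsub>Pol3\<^esub> {scal3 (varX ^ n) * Y3 - subst scal3 s3 P}"
  unfolding J_def idealR_def eval2_Pol3 s3_def scal3.map_power scal3_X by simp

lemma ideal_J: "ideal J Pol3"
  unfolding J_eq by (rule ideal_Idl)

text \<open>
  The solutions \<open>y = P(x,S)/x\<^sup>n\<close> and \<open>z = (Q(x,y) - S)/x\<^sup>e\<close> of the defining relations in \<open>K[S]\<close>.
\<close>

definition yL :: "'k fls poly" where
  "yL = Polynomial.smult (inverse (iota varX ^ n)) (subst (\<lambda>c. cst c) [:0, 1:] P)"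
definition zL :: "'k fls poly" where
  "zL = Polynomial.smult (inverse (iota varX ^ e)) (subst (\<lambda>c. cst c) yL Q - [:0, 1:])"

definition \<chi> :: "'k poly poly poly \<Rightarrow> 'k fls poly" where
  "\<chi> = subst (subst (\<lambda>c. cst c) yL) zL"

lemma ring_map_chi: "ring_map \<chi>"
  unfolding \<chi>_def by (intro ring_map.ring_map_subst ring_map_cst)

sublocale chi: ring_map \<chi> by (rule ring_map_chi)

lemma chi_gens: "\<chi> (scal3 c) = cst c" "\<chi> Y3 = yL" "\<chi> Z3 = zL"
proof -
  note 1 = ring_map.ring_map_subst[OF ring_map_cst, of yL]
  show "\<chi> (scal3 c) = cst c" "\<chi> Y3 = yL" "\<chi> Z3 = zL"
    unfolding \<chi>_def scal3_def Y3_def Z3_def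
    by (simp_all only: subst_const[OF 1] subst_var[OF 1] subst_const[OF ring_map_cst] subst_var[OF ring_map_cst])
qed

lemma chi_subst: "\<chi> (subst scal3 b q) = subst (\<lambda>c. cst c) (\<chi> b) q"
  by (simp add: subst_compose[OF ring_map_scal3 ring_map_chi] chi_gens)

lemma chi_s3: "\<chi> s3 = [:0, 1:]"
  by (simp add: s3_def chi_subst chi_gens zL_def cst_power)

lemma rel_s3: "s3 ^ d - (scal3 (varX ^ n) * Y3 - (\<Sum>t<d. scal3 (f t) * s3 ^ t)) \<in> J"
proof -
  have "scal3 (varX ^ n) * Y3 - subst scal3 s3 P \<in> J" unfolding J_eq by (rule in_Idl) simp
  then have "(-1) * (scal3 (varX ^ n) * Y3 - subst scal3 s3 P) \<in> J" by (rule ideal_type_closed(3)[OF ideal_J])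
  then show ?thesis by (simp add: P_def subst_monic[OF ring_map_scal3] algebra_simps)
qed

text \<open>
  This relation holds identically: it is the definition of \<open>s\<close> as \<open>Q(x,y) - x\<^sup>e z\<close>.
\<close>

lemma rel_Y3: "Y3 ^ m - (scal3 (varX ^ e) * Z3 + scal3 1 * s3 - (\<Sum>t<m. scal3 (g t) * Y3 ^ t)) \<in> J"
  using ideal_type_closed(1)[OF ideal_J]
  by (simp add: s3_def Q_def subst_monic[OF ring_map_scal3] algebra_simps)

sublocale Rnf: two_relations scal3 J s3 Y3 Z3 d m "varX ^ n" "varX ^ e" 1 f g
  by unfold_locales (use ideal_type_closed[OF ideal_J] d2 m2 rel_s3 rel_Y3 in auto)

lemma Rnf_spanned: "Rnf.spanned = UNIV"
proof -
  have "p \<in> Rnf.spanned" for p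
  proof (induction p rule: poly3_generated_induct)
    show "Y3 \<in> Rnf.spanned" using Rnf.spanned_monomial[of 0 1 0] by simp
    show "Z3 \<in> Rnf.spanned" using Rnf.spanned_monomial[of 0 0 1] by simp
  qed (rule Rnf.spanned_scalar Rnf.spanned_add Rnf.spanned_mult; assumption?)+
  then show ?thesis by blast
qed

lemma chi_J: "p \<in> J \<Longrightarrow> \<chi> p = 0"
  unfolding J_eq
  by (erule Idl_in_kernel[OF ring_map_chi, rotated]) (auto simp: chi_subst chi_gens chi_s3 yL_def cst_power)

sublocale Rnf: two_relations_eval scal3 J s3 Y3 Z3 d m "varX ^ n" "varX ^ e" 1 f g iota \<chi>
  by unfold_locales (use inj_iota chi_gens chi_s3 chi_J Rnf_spanned in auto)

text \<open>
  The leading terms of \<open>y\<close> and \<open>z\<close> in \<open>K[S]\<close>.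
\<close>

definition y0 :: "'k fls poly" where "y0 = Polynomial.monom (inverse (iota (varX ^ n))) d"
definition z0 :: "'k fls poly" where
  "z0 = Polynomial.monom (inverse (iota (varX ^ n) ^ m * iota (varX ^ e))) (m * d)"

definition \<theta> :: "'k poly poly poly poly \<Rightarrow> 'k fls poly" where
  "\<theta> = subst (subst (subst (\<lambda>c. cst c) y0) z0) [:0, 1:]"

lemma ring_map_theta: "ring_map \<theta>"
  unfolding \<theta>_def by (intro ring_map.ring_map_subst ring_map_cst)

sublocale theta: ring_map \<theta> by (rule ring_map_theta)

lemma theta_gens: "\<theta> (scal4 c) = cst c" "\<theta> Y4 = y0" "\<theta> Z4 = z0" "\<theta> S4 = [:0, 1:]"
proof -
  note 1 = ring_map.ring_map_subst[OF ring_map_cst, of y0]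
  note 2 = ring_map.ring_map_subst[OF 1, of z0]
  show "\<theta> (scal4 c) = cst c" "\<theta> Y4 = y0" "\<theta> Z4 = z0" "\<theta> S4 = [:0, 1:]"
    unfolding \<theta>_def scal4_def Y3_def Z3_def Y4_def Z4_def S4_def
    by (simp_all only: subst_const[OF 2] subst_var[OF 2] subst_const[OF 1] subst_var[OF 1]
        subst_const[OF ring_map_cst] subst_var[OF ring_map_cst])
qed

lemma scal4_X: "scal4 varX = X4" by (simp add: scal4_def X4_def X3_def)

definition I :: "'k poly poly poly poly set" where "I = idealG n e d m"

lemma I_eq: "I = Idl\<^bsub>Pol4\<^esub> {scal4 (varX ^ n) * Y4 - S4 ^ d, scal4 (varX ^ e) * Z4 - Y4 ^ m}"
  unfolding I_def idealG_def scal4.map_power scal4_X ..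

lemma ideal_I: "ideal I Pol4"
  unfolding I_eq by (rule ideal_Idl)

lemma rel_S4: "S4 ^ d - scal4 (varX ^ n) * Y4 \<in> I"
proof -
  have "scal4 (varX ^ n) * Y4 - S4 ^ d \<in> I" unfolding I_eq by (rule in_Idl) simp
  then have "(-1) * (scal4 (varX ^ n) * Y4 - S4 ^ d) \<in> I" by (rule ideal_type_closed(3)[OF ideal_I])
  then show ?thesis by simp
qed

lemma rel_Y4: "Y4 ^ m - scal4 (varX ^ e) * Z4 \<in> I"
proof -
  have "scal4 (varX ^ e) * Z4 - Y4 ^ m \<in> I" unfolding I_eq by (rule in_Idl) simp
  then have "(-1) * (scal4 (varX ^ e) * Z4 - Y4 ^ m) \<in> I" by (rule ideal_type_closed(3)[OF ideal_I])
  then show ?thesis by simp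
qed

sublocale Gnf: two_relations scal4 I S4 Y4 Z4 d m "varX ^ n" "varX ^ e" 0 "\<lambda>_. 0" "\<lambda>_. 0"
  by unfold_locales (use ideal_type_closed[OF ideal_I] d2 m2 rel_S4 rel_Y4 in auto)

lemma Gnf_spanned: "Gnf.spanned = UNIV"
proof -
  have "p \<in> Gnf.spanned" for p
  proof (induction p rule: poly4_generated_induct)
    show "Y4 \<in> Gnf.spanned" using Gnf.spanned_monomial[of 0 1 0] by simp
    show "Z4 \<in> Gnf.spanned" using Gnf.spanned_monomial[of 0 0 1] by simp
    show "S4 \<in> Gnf.spanned" using Gnf.spanned_monomial[of 1 0 0] by simp
  qed (rule Gnf.spanned_scalar Gnf.spanned_add Gnf.spanned_mult; assumption?)+
  then show ?thesis by blast
qed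

lemma theta_I: "p \<in> I \<Longrightarrow> \<theta> p = 0"
  unfolding I_eq
proof (erule Idl_in_kernel[OF ring_map_theta, rotated])
  fix a assume "a \<in> {scal4 (varX ^ n) * Y4 - S4 ^ d, scal4 (varX ^ e) * Z4 - Y4 ^ m}"
  then consider "a = scal4 (varX ^ n) * Y4 - S4 ^ d" | "a = scal4 (varX ^ e) * Z4 - Y4 ^ m" by blast
  then show "\<theta> a = 0"
  proof cases
    case 1
    then show ?thesis
      by (simp add: theta_gens y0_def smult_monom cst_power Polynomial.monom_altdef)
  next
    case 2
    show ?thesis unfolding 2
      by (simp add: theta_gens y0_def z0_def smult_monom cst_power monom_power field_simps)
  qed
qed

sublocale Gnf: two_relations_eval scal4 I S4 Y4 Z4 d m "varX ^ n" "varX ^ e" 0 "\<lambda>_. 0" "\<lambda>_. 0" iota \<theta>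
  by unfold_locales (use inj_iota theta_gens theta_I Gnf_spanned in auto)

text \<open>
  In the graded algebra the images of the variables are monomials in \<open>S\<close>, so the image of a normal
  monomial is equal to its leading term.
\<close>

lemma theta_nmon: "\<theta> (Gnf.nmon t) = Polynomial.monom (Gnf.\<xi> t) t"
proof -
  have "\<theta> (Gnf.nmon t) = Polynomial.monom (Gnf.\<xi> t) (t mod d + d * ((t div d) mod m) + m * d * (t div (m * d)))"
    unfolding Gnf.nmon_def
    by (simp add: theta_gens Gnf.X_power y0_def z0_def monom_power mult_monom Gnf.\<xi>_def del: power_inverse)
  then obtain t' where *: "\<theta> (Gnf.nmon t) = Polynomial.monom (Gnf.\<xi> t) t'" by blast
  have "Polynomial.degree (\<theta> (Gnf.nmon t)) = t'"
    unfolding * by (rule Polynomial.degree_monom_eq) (rule Gnf.xi_nonzero)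
  then have "t' = t" by (simp only: Gnf.chi_nmon)
  then show ?thesis by (simp only: *)
qed

text \<open>
  The coefficients at different powers of \<open>S\<close> can be prescribed independently, because normal
  monomials map to monomials. The coefficients \<open>\<xi>\<close> of the algebra \<open>R\<close> appear here, which is
  what links the graded algebra to the filtration of \<open>R\<close>.
\<close>

lemma range_theta: "range \<theta> = {p. \<forall>i. Polynomial.coeff p i \<in> range (\<lambda>c. iota c * Rnf.\<xi> i)}"
proof (intro equalityI subsetI)
  fix p assume "p \<in> range \<theta>"
  then obtain a where a: "p = \<theta> a" by blast
  have "a \<in> Gnf.spanned" by (simp add: Gnf_spanned)
  then obtain N c where "a - (\<Sum>t\<le>N. scal4 (c t) * Gnf.nmon t) \<in> I"
    unfolding Gnf.spanned_def Gnf.span_upto_def by blast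
  then have p: "p = (\<Sum>t\<le>N. Polynomial.monom (iota (c t) * Rnf.\<xi> t) t)"
    unfolding a by (simp add: Gnf.chi_cong Gnf.chi_sum theta_nmon smult_monom)
  have "Polynomial.coeff p i = iota (if i \<le> N then c i else 0) * Rnf.\<xi> i" for i
    unfolding p by (simp add: Polynomial.coeff_sum coeff_monom)
  then have "Polynomial.coeff p i \<in> range (\<lambda>c. iota c * Rnf.\<xi> i)" for i by (rule range_eqI)
  then show "p \<in> {p. \<forall>i. Polynomial.coeff p i \<in> range (\<lambda>c. iota c * Rnf.\<xi> i)}" by simp
next
  fix p assume "p \<in> {p. \<forall>i. Polynomial.coeff p i \<in> range (\<lambda>c. iota c * Rnf.\<xi> i)}"
  then have "\<forall>i. \<exists>c. Polynomial.coeff p i = iota c * Rnf.\<xi> i" by blast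
  then obtain c where c: "\<And>i. Polynomial.coeff p i = iota (c i) * Rnf.\<xi> i" by metis
  have "\<theta> (\<Sum>t\<le>Polynomial.degree p. scal4 (c t) * Gnf.nmon t) = (\<Sum>t\<le>Polynomial.degree p. Polynomial.monom (Polynomial.coeff p t) t)"
    by (simp add: Gnf.chi_sum theta_nmon smult_monom c)
  also have "\<dots> = p" by (rule poly_as_sum_of_monoms)
  finally show "p \<in> range \<theta>" by (intro range_eqI) (rule sym)
qed

end

section \<open>The derivation and its associated graded ring\<close>

context surface_data
begin

abbreviation R :: "'k poly poly poly set ring" where "R \<equiv> ringR n e P Q"
abbreviation cl :: "'k poly poly poly \<Rightarrow> 'k poly poly poly set" where "cl \<equiv> clsR n e P Q"

lemma cl_type_epi: "type_epi R cl"
  using type_epi_Quot[OF ideal_J] by (simp add: J_def clsR_def[abs_def] ringR_def)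

sublocale cl: type_epi R cl by (rule cl_type_epi)

lemma cl_eq_iff: "cl p = cl q \<longleftrightarrow> \<chi> p = \<chi> q"
  using Quot_coset_eq_iff[OF ideal_J, of p q] by (simp add: Rnf.chi_eq_iff J_def clsR_def)

lemma carrier_R_cases: "a \<in> carrier R \<Longrightarrow> (\<And>p. a = cl p \<Longrightarrow> thesis) \<Longrightarrow> thesis"
  using cl.surj by blast

text \<open>
  The embedding of \<open>R\<close> into \<open>K[S]\<close>; the choice of the representative does not matter by
  \<open>cl_eq_iff\<close>.
\<close>

definition \<psi> :: "'k poly poly poly set \<Rightarrow> 'k fls poly" where
  "\<psi> a = \<chi> (SOME p. cl p = a)"

lemma psi_cl [simp]: "\<psi> (cl p) = \<chi> p"
proof -
  have "cl (SOME q. cl q = cl p) = cl p" by (rule someI) (rule refl)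
  then show ?thesis unfolding \<psi>_def by (simp only: cl_eq_iff)
qed

lemma generated_R: "generated_algebra R (\<lambda>c. cl (C3 c)) {cl X3} = range (\<lambda>c. cl (scal3 c))"
  using cl.generated_image[OF ring_map_scal3] by (simp add: generated_algebra_def C3_def X3_def scal3_def)

end

locale surface_derivation = surface_data n e d m f g
  for n e d m :: nat and f g :: "nat \<Rightarrow> 'k::field_char_0 poly" +
  fixes D :: "'k poly poly poly set \<Rightarrow> 'k poly poly poly set"
  assumes der: "k_derivation R (\<lambda>c. cl (C3 c)) D"
    and D_x: "D (cl X3) = \<zero>\<^bsub>R\<^esub>"
    and D_y: "D (cl Y3) = cl (scal3 (varX ^ e) * subst scal3 s3 (pderiv P))"
    and D_z: "D (cl Z3) = cl (subst scal3 Y3 (pderiv Q) * subst scal3 s3 (pderiv P) - scal3 (varX ^ n))"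
begin

lemma D_closed: "a \<in> carrier R \<Longrightarrow> D a \<in> carrier R"
  using der by (auto simp: k_derivation_def)

lemma D_add: "a \<in> carrier R \<Longrightarrow> b \<in> carrier R \<Longrightarrow> D (a \<oplus>\<^bsub>R\<^esub> b) = D a \<oplus>\<^bsub>R\<^esub> D b"
  using der by (auto simp: k_derivation_def)

lemma D_mult: "a \<in> carrier R \<Longrightarrow> b \<in> carrier R \<Longrightarrow> D (a \<otimes>\<^bsub>R\<^esub> b) = D a \<otimes>\<^bsub>R\<^esub> b \<oplus>\<^bsub>R\<^esub> a \<otimes>\<^bsub>R\<^esub> D b"
  using der by (auto simp: k_derivation_def)

lemma psi_add: "a \<in> carrier R \<Longrightarrow> b \<in> carrier R \<Longrightarrow> \<psi> (a \<oplus>\<^bsub>R\<^esub> b) = \<psi> a + \<psi> b"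
  by (elim carrier_R_cases) (simp flip: cl.hom_add)

lemma psi_mult: "a \<in> carrier R \<Longrightarrow> b \<in> carrier R \<Longrightarrow> \<psi> (a \<otimes>\<^bsub>R\<^esub> b) = \<psi> a * \<psi> b"
  by (elim carrier_R_cases) (simp flip: cl.hom_mult)

text \<open>
  The given derivation, transported to a derivation of \<open>k[X,Y,Z]\<close> with values in \<open>K[S]\<close>, is to be
  compared with \<open>x\<^sup>n\<^sup>+\<^sup>e d/dS\<close>. The two agree on the constants and on \<open>X, Y, Z\<close>, where the second one
  is computed by differentiating the formulas for \<open>y\<close> and \<open>z\<close>.
\<close>

definition \<Delta> :: "'k poly poly poly \<Rightarrow> 'k fls poly" where "\<Delta> p = \<psi> (D (cl p))"
definition \<delta> :: "'k fls poly \<Rightarrow> 'k fls poly" where "\<delta> q = Polynomial.smult (iota (varX ^ (n + e))) (pderiv q)"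

lemma \<Delta>_add: "\<Delta> (p + q) = \<Delta> p + \<Delta> q"
  by (simp add: \<Delta>_def cl.hom_add D_add psi_add D_closed)

lemma \<Delta>_mult: "\<Delta> (p * q) = \<Delta> p * \<chi> q + \<chi> p * \<Delta> q"
  by (simp add: \<Delta>_def cl.hom_mult D_mult psi_add psi_mult D_closed)

lemma \<Delta>_1: "\<Delta> 1 = 0"
  using \<Delta>_mult[of 1 1] by simp

lemma \<Delta>_const: "\<Delta> (C3 c) = 0"
proof -
  \<comment> \<open>By linearity over \<open>k\<close> it suffices that the derivative of \<open>1\<close> vanishes.\<close>
  have "D (cl (C3 c) \<otimes>\<^bsub>R\<^esub> cl 1) = cl (C3 c) \<otimes>\<^bsub>R\<^esub> D (cl 1)"
    using der by (auto simp: k_derivation_def)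
  then have "\<Delta> (C3 c) = \<chi> (C3 c) * \<Delta> 1"
    by (simp add: \<Delta>_def D_closed psi_mult flip: cl.hom_mult)
  then show ?thesis by (simp add: \<Delta>_1)
qed

lemma \<delta>_add: "\<delta> (p + q) = \<delta> p + \<delta> q"
  by (simp add: \<delta>_def pderiv_add smult_add_right)

lemma \<delta>_mult: "\<delta> (p * q) = \<delta> p * q + p * \<delta> q"
  by (simp add: \<delta>_def pderiv_mult smult_add_right algebra_simps)

lemma \<delta>_yL: "\<delta> yL = cst (varX ^ e) * subst (\<lambda>c. cst c) [:0, 1:] (pderiv P)"
  by (simp add: \<delta>_def yL_def pderiv_smult pderiv_subst[OF ring_map_iota] power_add cst_power pderiv_pCons field_simps)

lemma \<delta>_zL: "\<delta> zL = subst (\<lambda>c. cst c) yL (pderiv Q) * subst (\<lambda>c. cst c) [:0, 1:] (pderiv P) - cst (varX ^ n)"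
proof -
  have "\<delta> zL = Polynomial.smult (iota varX ^ n) (subst (\<lambda>c. cst c) yL (pderiv Q) * pderiv yL - 1)"
    by (simp add: \<delta>_def zL_def pderiv_smult pderiv_diff pderiv_subst[OF ring_map_iota] power_add pderiv_pCons one_pCons field_simps)
  also have "\<dots> = subst (\<lambda>c. cst c) yL (pderiv Q) * Polynomial.smult (iota varX ^ n) (pderiv yL) - cst (varX ^ n)"
    by (simp add: smult_diff_right)
  also have "Polynomial.smult (iota varX ^ n) (pderiv yL) = subst (\<lambda>c. cst c) [:0, 1:] (pderiv P)"
    by (simp add: yL_def pderiv_smult pderiv_subst[OF ring_map_iota] pderiv_pCons)
  finally show ?thesis .
qed

lemma \<Delta>_eq: "\<Delta> p = \<delta> (\<chi> p)"
proof (induction p rule: derivation_along_eqI[where v = \<chi>])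
  fix c2 :: "'k poly poly"
  show "\<Delta> [:c2:] = \<delta> (\<chi> [:c2:])"
  proof (induction c2 rule: derivation_along_eqI[where v = "\<lambda>c. \<chi> [:c:]"])
    fix c1 :: "'k poly"
    show "\<Delta> [:[:c1:]:] = \<delta> (\<chi> [:[:c1:]:])"
    proof (induction c1 rule: derivation_along_eqI[where v = "\<lambda>c. \<chi> [:[:c:]:]"])
      fix c :: 'k
      have "\<chi> (C3 c) = cst [:c:]" using chi_gens(1)[of "[:c:]"] by (simp add: scal3_def C3_def)
      then show "\<Delta> [:[:[:c:]:]:] = \<delta> (\<chi> [:[:[:c:]:]:])"
        using \<Delta>_const[of c] by (simp add: C3_def \<delta>_def pderiv_pCons)
    next
      have "\<Delta> X3 = \<psi> (cl 0)" by (simp add: \<Delta>_def D_x cl.hom_0)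
      moreover have "\<chi> X3 = cst varX" using chi_gens(1)[of varX] by (simp add: scal3_X)
      ultimately show "\<Delta> [:[:[:0, 1:]:]:] = \<delta> (\<chi> [:[:[:0, 1:]:]:])"
        by (simp add: X3_def \<delta>_def pderiv_pCons)
    next
      fix p q :: "'k poly"
      show "\<Delta> [:[:p + q:]:] = \<Delta> [:[:p:]:] + \<Delta> [:[:q:]:]" using \<Delta>_add[of "[:[:p:]:]" "[:[:q:]:]"] by simp
      show "\<delta> (\<chi> [:[:p + q:]:]) = \<delta> (\<chi> [:[:p:]:]) + \<delta> (\<chi> [:[:q:]:])"
        using \<delta>_add[of "\<chi> [:[:p:]:]" "\<chi> [:[:q:]:]"] by (simp flip: chi.map_add)
      show "\<Delta> [:[:p * q:]:] = \<Delta> [:[:p:]:] * \<chi> [:[:q:]:] + \<chi> [:[:p:]:] * \<Delta> [:[:q:]:]"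
        using \<Delta>_mult[of "[:[:p:]:]" "[:[:q:]:]"] by (simp add: mult.commute[of p])
      show "\<delta> (\<chi> [:[:p * q:]:]) = \<delta> (\<chi> [:[:p:]:]) * \<chi> [:[:q:]:] + \<chi> [:[:p:]:] * \<delta> (\<chi> [:[:q:]:])"
        using \<delta>_mult[of "\<chi> [:[:p:]:]" "\<chi> [:[:q:]:]"] by (simp add: mult.commute[of p] flip: chi.map_mult)
    qed
  next
    show "\<Delta> [:[:0, 1:]:] = \<delta> (\<chi> [:[:0, 1:]:])"
      unfolding Y3_def[symmetric] by (simp add: \<Delta>_def D_y chi_gens chi_subst chi_s3 \<delta>_yL cst_power)
  next
    fix p q :: "'k poly poly"
    show "\<Delta> [:p + q:] = \<Delta> [:p:] + \<Delta> [:q:]" using \<Delta>_add[of "[:p:]" "[:q:]"] by simp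
    show "\<delta> (\<chi> [:p + q:]) = \<delta> (\<chi> [:p:]) + \<delta> (\<chi> [:q:])"
      using \<delta>_add[of "\<chi> [:p:]" "\<chi> [:q:]"] by (simp flip: chi.map_add)
    show "\<Delta> [:p * q:] = \<Delta> [:p:] * \<chi> [:q:] + \<chi> [:p:] * \<Delta> [:q:]"
      using \<Delta>_mult[of "[:p:]" "[:q:]"] by (simp add: mult.commute[of p])
    show "\<delta> (\<chi> [:p * q:]) = \<delta> (\<chi> [:p:]) * \<chi> [:q:] + \<chi> [:p:] * \<delta> (\<chi> [:q:])"
      using \<delta>_mult[of "\<chi> [:p:]" "\<chi> [:q:]"] by (simp add: mult.commute[of p] flip: chi.map_mult)
  qed
next
  show "\<Delta> [:0, 1:] = \<delta> (\<chi> [:0, 1:])"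
    unfolding Z3_def[symmetric] by (simp add: \<Delta>_def D_z chi_gens chi_subst chi_s3 \<delta>_zL cst_power)
qed (simp_all add: \<Delta>_add \<Delta>_mult \<delta>_add \<delta>_mult)

lemma embedded: "embedded_derivation R \<psi> D (iota (varX ^ (n + e)))"
proof (intro embedded_derivation.intro embedded_derivation_axioms.intro)
  show "cring R"
    unfolding ringR_def J_def[symmetric]
    by (rule ideal.quotient_is_cring[OF ideal_J]) (rule cring_from_type_algebra)
  show "\<psi> \<one>\<^bsub>R\<^esub> = 1" by (simp flip: cl.hom_1)
  show "inj_on \<psi> (carrier R)" by (rule inj_onI) (elim carrier_R_cases, simp add: cl_eq_iff)
  show "\<psi> (D a) = Polynomial.smult (iota (varX ^ (n + e))) (pderiv (\<psi> a))" if "a \<in> carrier R" for a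
    using that by (rule carrier_R_cases) (use \<Delta>_eq in \<open>simp add: \<Delta>_def \<delta>_def\<close>)
qed (simp_all add: psi_add psi_mult D_closed)

sublocale E: embedded_derivation R \<psi> D "iota (varX ^ (n + e))"
  by (rule embedded)

lemma lead_values_eq: "E.lead_values i = range (\<lambda>c. iota c * Rnf.\<xi> i)"
proof -
  have "E.lead_values i = {Polynomial.coeff (\<chi> a) i |a. \<forall>t>i. Polynomial.coeff (\<chi> a) t = 0}"
    unfolding E.lead_values_def by (auto elim!: carrier_R_cases) (metis cl.hom_closed psi_cl)
  then show ?thesis by (simp only: Rnf.leading_coeffs)
qed

lemma graded_subring_eq: "range \<theta> = E.graded_subring"
  by (simp add: E.graded_subring_def lead_values_eq range_theta)

text \<open>
  The homomorphism from \<open>k[X,Y,Z,S]\<close> to the associated graded ring with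
  \<open>X, Y, Z, S \<mapsto> x', y', z', s'\<close>. It factors through the model inside \<open>K[S]\<close>, so its surjectivity
  and its kernel are already known.
\<close>

definition \<eta> :: "'k poly poly poly poly \<Rightarrow> nat \<Rightarrow> 'k poly poly poly set set" where
  "\<eta> p = E.to_Gr (\<theta> p)"

sublocale H: type_epi "Gr R D" \<eta>
  unfolding \<eta>_def[abs_def] by (rule E.Gr_type_epi[OF ring_map_theta graded_subring_eq])

lemma eta_eq_iff: "\<eta> p = \<eta> q \<longleftrightarrow> p - q \<in> I"
proof -
  have "\<theta> p \<in> E.graded_subring" "\<theta> q \<in> E.graded_subring" using graded_subring_eq by auto
  then show ?thesis unfolding \<eta>_def Gnf.chi_eq_iff[symmetric] by (rule inj_on_eq_iff[OF E.to_Gr_inj])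
qed

text \<open>
  That \<open>\<eta>\<close> sends the variables to the leading classes of \<open>x, y, z, s\<close> is a comparison of leading
  terms in \<open>K[S]\<close>.
\<close>

lemma gr_const_eq: "gr_const R (\<lambda>c. cl (C3 c)) D c = \<eta> (C4 c)"
proof -
  have c: "\<chi> (C3 c) = cst [:c:]" "\<theta> (C4 c) = cst [:c:]"
    using chi_gens(1)[of "[:c:]"] theta_gens(1)[of "[:c:]"] by (simp_all add: scal3_def C3_def scal4_def C4_def)
  have "cl (C3 c) \<in> filtr R D (int 0)"
    unfolding E.filtr_nat by (auto simp: c coeff_pCons split: nat.splits)
  from E.gr_class_eq[OF this] show ?thesis
    by (simp add: gr_const_def \<eta>_def c Polynomial.monom_0)
qed

lemma gr_x: "gr R D (cl X3) = \<eta> X4"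
proof -
  have "\<chi> X3 = cst varX" "\<theta> X4 = cst varX"
    using chi_gens(1)[of varX] theta_gens(1)[of varX] by (simp_all add: scal3_X scal4_X)
  then show ?thesis by (simp add: E.gr_eq \<eta>_def Polynomial.monom_0)
qed

lemma gr_y: "gr R D (cl Y3) = \<eta> Y4"
  unfolding E.gr_eq[OF cl.hom_closed] psi_cl Rnf.chi_y(2) unfolding Rnf.chi_y(1) \<eta>_def theta_gens y0_def ..

lemma gr_z: "gr R D (cl Z3) = \<eta> Z4"
  unfolding E.gr_eq[OF cl.hom_closed] psi_cl Rnf.chi_z(2) unfolding Rnf.chi_z(1) \<eta>_def theta_gens z0_def ..

lemma gr_s: "gr R D (cl s3) = \<eta> S4"
  by (simp add: E.gr_eq chi_s3 \<eta>_def theta_gens monom_Suc Polynomial.monom_0)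

lemma D_s: "D (cl s3) = cl X3 [^]\<^bsub>R\<^esub> (n + e)"
proof -
  have "\<psi> (D (cl s3)) = \<chi> (X3 ^ (n + e))"
    using \<Delta>_eq[of s3] by (simp add: \<Delta>_def \<delta>_def chi_s3 pderiv_pCons chi_gens flip: scal3_X scal3.map_power)
  then have "D (cl s3) = cl (X3 ^ (n + e))"
    using inj_onD[OF E.psi_inj, of "D (cl s3)" "cl (X3 ^ (n + e))"] by (simp add: D_closed del: chi.map_power)
  then show ?thesis by (simp only: cl.hom_power)
qed

text \<open>
  An element of degree at most \<open>N\<close> is a combination of normal monomials of weight at most \<open>N\<close>.
  Its last summand is the product of an element of \<open>k[x]\<close> with the single monomial of weight \<open>N\<close>,
  and the remaining summands have smaller degree.
\<close>

lemma filtration: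
  fixes i j l :: nat
  assumes "j < m" "l < d"
  defines "N \<equiv> m * d * i + d * j + l"
  shows "filtr R D (int N) =
    (\<lambda>p. p \<otimes>\<^bsub>R\<^esub> cl s3 [^]\<^bsub>R\<^esub> l \<otimes>\<^bsub>R\<^esub> cl Y3 [^]\<^bsub>R\<^esub> j \<otimes>\<^bsub>R\<^esub> cl Z3 [^]\<^bsub>R\<^esub> i)
      ` generated_algebra R (\<lambda>c. cl (C3 c)) {cl X3} <+>\<^bsub>R\<^esub> filtr R D (int N - 1)"
proof -
  have b: "Rnf.nmon N = s3 ^ l * Y3 ^ j * Z3 ^ i"
    unfolding N_def by (rule Rnf.nmon_weight) fact+
  have "(\<lambda>p. p \<otimes>\<^bsub>R\<^esub> cl s3 [^]\<^bsub>R\<^esub> l \<otimes>\<^bsub>R\<^esub> cl Y3 [^]\<^bsub>R\<^esub> j \<otimes>\<^bsub>R\<^esub> cl Z3 [^]\<^bsub>R\<^esub> i)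
      ` generated_algebra R (\<lambda>c. cl (C3 c)) {cl X3} = range (\<lambda>c. cl (scal3 c * Rnf.nmon N))"
    unfolding generated_R b image_image
    by (simp add: mult.assoc flip: cl.hom_power cl.hom_mult)
  moreover have "filtr R D (int N) = range (\<lambda>c. cl (scal3 c * Rnf.nmon N)) <+>\<^bsub>R\<^esub> E.lead_class N 0"
  proof (intro equalityI subsetI)
    fix a assume "a \<in> filtr R D (int N)"
    then obtain p where a: "a = cl p" and p: "\<And>t. t > N \<Longrightarrow> Polynomial.coeff (\<chi> p) t = 0"
      unfolding E.filtr_nat by (auto elim!: carrier_R_cases)
    obtain c where c: "p - (\<Sum>t\<le>N. scal3 (c t) * Rnf.nmon t) \<in> J"
      using Rnf.degree_le_imp_span[OF p] unfolding Rnf.span_upto_def by blast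
    define r where "r = p - scal3 (c N) * Rnf.nmon N"
    have "\<chi> r = \<chi> (\<Sum>t\<le>N. scal3 (c t) * Rnf.nmon t) - \<chi> (scal3 (c N) * Rnf.nmon N)"
      unfolding r_def using Rnf.chi_cong[OF c] by simp
    moreover have "\<chi> (scal3 (c N) * Rnf.nmon N) = Polynomial.smult (iota (c N)) (\<chi> (Rnf.nmon N))"
      by (simp add: chi_gens)
    ultimately have "Polynomial.coeff (\<chi> r) t = 0" if "t \<ge> N" for t
      using Rnf.coeff_chi_sum[where c = c and N = N] Rnf.chi_nmon[of N] that
      by (cases "t = N") (simp_all add: coeff_eq_0)
    then have "cl r \<in> E.lead_class N 0" by (simp add: E.lead_class_def)
    moreover have "a = cl (scal3 (c N) * Rnf.nmon N) \<oplus>\<^bsub>R\<^esub> cl r"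
      by (simp add: a r_def flip: cl.hom_add)
    ultimately show "a \<in> range (\<lambda>c. cl (scal3 c * Rnf.nmon N)) <+>\<^bsub>R\<^esub> E.lead_class N 0"
      unfolding set_add_def' by blast
  next
    fix a assume "a \<in> range (\<lambda>c. cl (scal3 c * Rnf.nmon N)) <+>\<^bsub>R\<^esub> E.lead_class N 0"
    then obtain c b where a: "a = cl (scal3 c * Rnf.nmon N) \<oplus>\<^bsub>R\<^esub> b" "b \<in> E.lead_class N 0"
      unfolding set_add_def' by blast
    have "cl (scal3 c * Rnf.nmon N) \<in> E.lead_class N (iota c * Rnf.\<xi> N)"
      using Rnf.chi_nmon[of N] by (simp add: E.lead_class_def chi_gens coeff_eq_0)
    from E.lead_class_add[OF this a(2)] show "a \<in> filtr R D (int N)"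
      unfolding a(1) E.filtr_nat by (simp add: E.lead_class_def)
  qed
  ultimately show ?thesis by (simp add: E.filtr_pred)
qed

lemma generated_Gr_x: "generated_algebra (Gr R D) (\<lambda>c. \<eta> (C4 c)) {\<eta> X4} = range (\<lambda>c. \<eta> (scal4 c))"
  using H.generated_image[OF ring_map_scal4]
  by (simp add: generated_algebra_def C4_def C3_def X4_def X3_def scal4_def)

lemma generated_Gr:
  "carrier (Gr R D) = generated_algebra (Gr R D) (\<lambda>c. \<eta> (C4 c)) {\<eta> X4, \<eta> Y4, \<eta> Z4, \<eta> S4}"
    (is "_ = ?A")
proof (intro equalityI subsetI)
  fix v assume "v \<in> carrier (Gr R D)"
  then obtain p where v: "v = \<eta> p" using H.surj by auto
  have add: "\<eta> a \<in> ?A \<Longrightarrow> \<eta> b \<in> ?A \<Longrightarrow> \<eta> (a + b) \<in> ?A"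
    and mult: "\<eta> a \<in> ?A \<Longrightarrow> \<eta> b \<in> ?A \<Longrightarrow> \<eta> (a * b) \<in> ?A" for a b
    by (auto simp: H.hom_add H.hom_mult generated_algebra_def intro: generate_ring.intros)
  have gens: "\<eta> (C4 c) \<in> ?A" "\<eta> X4 \<in> ?A" "\<eta> Y4 \<in> ?A" "\<eta> Z4 \<in> ?A" "\<eta> S4 \<in> ?A" for c
    by (auto simp: generated_algebra_def intro: generate_ring.incl)
  have scal: "\<eta> (scal4 c) \<in> ?A" for c
  proof (induction c rule: poly_generated_induct)
    case (3 a b)
    then show ?case using add[of "scal4 a" "scal4 b"] by (simp add: scal4_def)
  next
    case (4 a b)
    then show ?case using mult[of "scal4 a" "scal4 b"] by (simp add: scal4_def mult.commute)
  qed (use gens in \<open>simp_all add: scal4_def C4_def C3_def X4_def X3_def\<close>)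
  show "v \<in> ?A" unfolding v
    by (induction p rule: poly4_generated_induct) (use scal gens add mult in simp_all)
next
  fix v assume "v \<in> ?A"
  then show "v \<in> carrier (Gr R D)"
    unfolding generated_algebra_def by (rule H.generate_ring_in_carrier[rotated]) auto
qed

lemma Gr_piece_normal_form:
  assumes "j < m" "l < d"
  shows "Gr_piece R D (m * d * i + d * j + l) =
    (\<lambda>p. p \<otimes>\<^bsub>Gr R D\<^esub> \<eta> S4 [^]\<^bsub>Gr R D\<^esub> l \<otimes>\<^bsub>Gr R D\<^esub> \<eta> Y4 [^]\<^bsub>Gr R D\<^esub> j \<otimes>\<^bsub>Gr R D\<^esub> \<eta> Z4 [^]\<^bsub>Gr R D\<^esub> i)
      ` generated_algebra (Gr R D) (\<lambda>c. \<eta> (C4 c)) {\<eta> X4}"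
proof -
  let ?N = "m * d * i + d * j + l"
  have "(\<lambda>p. p \<otimes>\<^bsub>Gr R D\<^esub> \<eta> S4 [^]\<^bsub>Gr R D\<^esub> l \<otimes>\<^bsub>Gr R D\<^esub> \<eta> Y4 [^]\<^bsub>Gr R D\<^esub> j \<otimes>\<^bsub>Gr R D\<^esub> \<eta> Z4 [^]\<^bsub>Gr R D\<^esub> i)
      ` generated_algebra (Gr R D) (\<lambda>c. \<eta> (C4 c)) {\<eta> X4} = range (\<lambda>c. \<eta> (scal4 c * Gnf.nmon ?N))"
    unfolding generated_Gr_x Gnf.nmon_weight[OF assms(2,1)] image_image
    by (simp add: mult.assoc flip: H.hom_power H.hom_mult)
  also have "\<dots> = range (\<lambda>c. E.to_Gr (Polynomial.monom (iota c * Rnf.\<xi> ?N) ?N))"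
    unfolding \<eta>_def by (simp add: theta_gens theta_nmon smult_monom)
  finally show ?thesis by (simp only: E.Gr_piece_eq lead_values_eq image_image)
qed

lemma relations:
  "\<eta> X4 [^]\<^bsub>Gr R D\<^esub> n \<otimes>\<^bsub>Gr R D\<^esub> \<eta> Y4 = \<eta> S4 [^]\<^bsub>Gr R D\<^esub> d"
  "\<eta> X4 [^]\<^bsub>Gr R D\<^esub> e \<otimes>\<^bsub>Gr R D\<^esub> \<eta> Z4 = \<eta> Y4 [^]\<^bsub>Gr R D\<^esub> m"
proof -
  have "\<eta> (X4 ^ n * Y4) = \<eta> (S4 ^ d)" "\<eta> (X4 ^ e * Z4) = \<eta> (Y4 ^ m)"
    using rel_S4 rel_Y4 by (simp_all add: scal4_X eta_eq_iff[of "S4 ^ d"] eta_eq_iff[of "Y4 ^ m"] eq_commute[of "\<eta> (_ * _)"])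
  then show "\<eta> X4 [^]\<^bsub>Gr R D\<^esub> n \<otimes>\<^bsub>Gr R D\<^esub> \<eta> Y4 = \<eta> S4 [^]\<^bsub>Gr R D\<^esub> d"
    "\<eta> X4 [^]\<^bsub>Gr R D\<^esub> e \<otimes>\<^bsub>Gr R D\<^esub> \<eta> Z4 = \<eta> Y4 [^]\<^bsub>Gr R D\<^esub> m"
    by (simp_all only: H.hom_power H.hom_mult)
qed

lemma presentation:
  "\<exists>\<phi>\<in>ring_iso (ringG n e d m) (Gr R D). \<forall>p. \<phi> (clsG n e d m p) = \<eta> p"
proof -
  interpret G: type_epi "ringG n e d m :: 'k poly poly poly poly set ring" "clsG n e d m"
    using type_epi_Quot[OF ideal_I] by (simp add: I_def clsG_def[abs_def] ringG_def)
  have cls: "clsG n e d m p = clsG n e d m q \<longleftrightarrow> \<eta> p = \<eta> q" for p q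
    using Quot_coset_eq_iff[OF ideal_I, of p q] by (simp add: eta_eq_iff I_def clsG_def)
  define \<phi> where "\<phi> U = \<eta> (SOME p. clsG n e d m p = U)" for U
  have phi: "\<phi> (clsG n e d m p) = \<eta> p" for p
  proof -
    have "clsG n e d m (SOME q. clsG n e d m q = clsG n e d m p) = clsG n e d m p"
      by (rule someI) (rule refl)
    then show ?thesis unfolding \<phi>_def by (simp only: cls)
  qed
  have "\<phi> \<in> ring_iso (ringG n e d m) (Gr R D)"
  proof (rule ring_iso_memI)
    have "inj_on \<phi> (range (clsG n e d m))" by (rule inj_onI, elim rangeE) (simp only: phi cls)
    moreover have "\<phi> ` range (clsG n e d m) = range \<eta>" by (simp add: image_image phi)
    ultimately show "bij_betw \<phi> (carrier (ringG n e d m)) (carrier (Gr R D))"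
      by (simp add: bij_betw_def G.surj H.surj)
  qed (auto simp: phi H.hom_add H.hom_mult H.hom_1 simp flip: G.surj G.hom_1 G.hom_add G.hom_mult)
  then show ?thesis using phi by blast
qed

end

theorem theorem4p5:
  fixes n e d m :: nat
    and f g :: "nat \<Rightarrow> 'k::field_char_0 poly"
    and P Q :: "'k poly poly"
    and R :: "'k poly poly poly set ring"
    and \<kappa> :: "'k \<Rightarrow> 'k poly poly poly set"
    and x y z s :: "'k poly poly poly set"
    and D :: "'k poly poly poly set \<Rightarrow> 'k poly poly poly set"
    and F :: "int \<Rightarrow> 'k poly poly poly set set"
    and G :: "(nat \<Rightarrow> 'k poly poly poly set set) ring"
    and \<kappa>G :: "'k \<Rightarrow> nat \<Rightarrow> 'k poly poly poly set set"
    and x' y' z' s' :: "nat \<Rightarrow> 'k poly poly poly set set"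
  assumes "n \<ge> 1" and "(n, e) \<noteq> (1, 0)" and "d \<ge> 2" and "m \<ge> 2"
    and "P = Polynomial.monom 1 d + (\<Sum>i<d. Polynomial.monom (f i) i)"
    and "Q = Polynomial.monom 1 m + (\<Sum>j<m. Polynomial.monom (g j) j)"
    and "R = ringR n e P Q"
    and "\<kappa> = (\<lambda>c. clsR n e P Q (C3 c))"
    and "x = clsR n e P Q X3" and "y = clsR n e P Q Y3" and "z = clsR n e P Q Z3"
    and "s = eval2 R \<kappa> Q x y \<ominus>\<^bsub>R\<^esub> x [^]\<^bsub>R\<^esub> e \<otimes>\<^bsub>R\<^esub> z"
    and "k_derivation R \<kappa> D" and "locally_nilpotent R D"
    and "D x = \<zero>\<^bsub>R\<^esub>"
    and "D y = x [^]\<^bsub>R\<^esub> e \<otimes>\<^bsub>R\<^esub> eval2 R \<kappa> (pderiv P) x s"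
    and "D z = eval2 R \<kappa> (pderiv Q) x y \<otimes>\<^bsub>R\<^esub> eval2 R \<kappa> (pderiv P) x s \<ominus>\<^bsub>R\<^esub> x [^]\<^bsub>R\<^esub> n"
    and "F = filtr R D"
    and "G = Gr R D"
    and "\<kappa>G = gr_const R \<kappa> D"
    and "x' = gr R D x" and "y' = gr R D y" and "z' = gr R D z" and "s' = gr R D s"
  shows "D s = x [^]\<^bsub>R\<^esub> (n + e) \<and>
         (\<forall>i j l. j < m \<and> l < d \<longrightarrow>
           F (int (m * d * i + d * j + l)) =
             (\<lambda>p. p \<otimes>\<^bsub>R\<^esub> s [^]\<^bsub>R\<^esub> l \<otimes>\<^bsub>R\<^esub> y [^]\<^bsub>R\<^esub> j \<otimes>\<^bsub>R\<^esub> z [^]\<^bsub>R\<^esub> i) ` generated_algebra R \<kappa> {x}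
             <+>\<^bsub>R\<^esub> F (int (m * d * i + d * j + l) - 1)) \<and>
         carrier G = generated_algebra G \<kappa>G {x', y', z', s'} \<and>
         x' [^]\<^bsub>G\<^esub> n \<otimes>\<^bsub>G\<^esub> y' = s' [^]\<^bsub>G\<^esub> d \<and>
         x' [^]\<^bsub>G\<^esub> e \<otimes>\<^bsub>G\<^esub> z' = y' [^]\<^bsub>G\<^esub> m \<and>
         (\<exists>\<phi>\<in>ring_iso (ringG n e d m) G.
           (\<forall>c. \<phi> (clsG n e d m (C4 c)) = \<kappa>G c) \<and>
           \<phi> (clsG n e d m X4) = x' \<and> \<phi> (clsG n e d m Y4) = y' \<and>
           \<phi> (clsG n e d m Z4) = z' \<and> \<phi> (clsG n e d m S4) = s') \<and>
         (\<forall>i j l. j < m \<and> l < d \<longrightarrow>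
           Gr_piece R D (m * d * i + d * j + l) =
             (\<lambda>p. p \<otimes>\<^bsub>G\<^esub> s' [^]\<^bsub>G\<^esub> l \<otimes>\<^bsub>G\<^esub> y' [^]\<^bsub>G\<^esub> j \<otimes>\<^bsub>G\<^esub> z' [^]\<^bsub>G\<^esub> i)
               ` generated_algebra G \<kappa>G {x'})"
proof -
  interpret surface_data n e d m f g
    using assms(3,4) by unfold_locales
  have PQ: "P = surface_data.P d f" "Q = surface_data.Q m g"
    using assms(5,6) by (simp_all add: P_def Q_def)
  note defs = assms(7-11)[unfolded PQ]
  have eval: "eval2 R \<kappa> q x (clsR n e P Q b) = clsR n e P Q (subst scal3 b q)" for q b
    unfolding defs(1-3) PQ by (rule cl.eval2_eq[OF cl_type_epi])
  have xN: "x [^]\<^bsub>R\<^esub> N = clsR n e P Q (scal3 (varX ^ N))" for N :: nat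
    unfolding defs(1,3) PQ by (simp add: scal3_X cl.hom_power)
  have s: "s = clsR n e P Q s3"
    unfolding assms(10-12) eval xN unfolding assms(7) PQ by (simp add: s3_def cl.hom_mult cl.hom_diff)
  interpret surface_derivation n e d m f g D
  proof unfold_locales
    show "k_derivation (ringR n e (surface_data.P d f) (surface_data.Q m g))
      (\<lambda>c. clsR n e (surface_data.P d f) (surface_data.Q m g) (C3 c)) D"
      using assms(13) unfolding defs(1,2) .
    show "D (clsR n e (surface_data.P d f) (surface_data.Q m g) X3)
      = \<zero>\<^bsub>ringR n e (surface_data.P d f) (surface_data.Q m g)\<^esub>"
      using assms(15) unfolding defs(1,3) .
    show "D (clsR n e (surface_data.P d f) (surface_data.Q m g) Y3)
      = clsR n e (surface_data.P d f) (surface_data.Q m g) (scal3 (varX ^ e) * subst scal3 s3 (pderiv (surface_data.P d f)))"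
      using assms(16) unfolding s xN eval assms(10) unfolding assms(7) PQ cl.hom_mult[symmetric] .
    show "D (clsR n e (surface_data.P d f) (surface_data.Q m g) Z3)
      = clsR n e (surface_data.P d f) (surface_data.Q m g)
        (subst scal3 Y3 (pderiv (surface_data.Q m g)) * subst scal3 s3 (pderiv (surface_data.P d f)) - scal3 (varX ^ n))"
      using assms(17)
      unfolding s xN assms(10,11) eval unfolding assms(7) PQ cl.hom_mult[symmetric] cl.hom_diff[symmetric] .
  qed
  have gens: "\<kappa>G = (\<lambda>c. \<eta> (C4 c))" "x' = \<eta> X4" "y' = \<eta> Y4" "z' = \<eta> Z4" "s' = \<eta> S4"
    unfolding assms(20-24) s unfolding defs PQ
    by (simp_all only: gr_x gr_y gr_z gr_s gr_const_eq[abs_def])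
  note G = assms(19)[unfolded defs(1)]
  have 1: "D s = x [^]\<^bsub>R\<^esub> (n + e)"
    unfolding s unfolding defs PQ by (rule D_s)
  have 2: "F (int (m * d * i + d * j + l)) =
      (\<lambda>p. p \<otimes>\<^bsub>R\<^esub> s [^]\<^bsub>R\<^esub> l \<otimes>\<^bsub>R\<^esub> y [^]\<^bsub>R\<^esub> j \<otimes>\<^bsub>R\<^esub> z [^]\<^bsub>R\<^esub> i) ` generated_algebra R \<kappa> {x}
        <+>\<^bsub>R\<^esub> F (int (m * d * i + d * j + l) - 1)" if "j < m" "l < d" for i j l
    unfolding s assms(18) unfolding defs PQ by (rule filtration[OF that])
  obtain \<phi> where phi: "\<phi> \<in> ring_iso (ringG n e d m) G" "\<And>p. \<phi> (clsG n e d m p) = \<eta> p"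
    using presentation unfolding G by blast
  have 3: "\<exists>\<phi>\<in>ring_iso (ringG n e d m) G.
      (\<forall>c. \<phi> (clsG n e d m (C4 c)) = \<kappa>G c) \<and>
      \<phi> (clsG n e d m X4) = x' \<and> \<phi> (clsG n e d m Y4) = y' \<and>
      \<phi> (clsG n e d m Z4) = z' \<and> \<phi> (clsG n e d m S4) = s'"
    unfolding gens using phi by (intro bexI[of _ \<phi>]) simp_all
  have 4: "Gr_piece R D (m * d * i + d * j + l) =
      (\<lambda>p. p \<otimes>\<^bsub>G\<^esub> s' [^]\<^bsub>G\<^esub> l \<otimes>\<^bsub>G\<^esub> y' [^]\<^bsub>G\<^esub> j \<otimes>\<^bsub>G\<^esub> z' [^]\<^bsub>G\<^esub> i) ` generated_algebra G \<kappa>G {x'}"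
    if "j < m" "l < d" for i j l
    unfolding gens G defs(1) by (rule Gr_piece_normal_form[OF that])
  have 5: "carrier G = generated_algebra G \<kappa>G {x', y', z', s'}"
    unfolding gens G by (rule generated_Gr)
  have 6: "x' [^]\<^bsub>G\<^esub> n \<otimes>\<^bsub>G\<^esub> y' = s' [^]\<^bsub>G\<^esub> d" "x' [^]\<^bsub>G\<^esub> e \<otimes>\<^bsub>G\<^esub> z' = y' [^]\<^bsub>G\<^esub> m"
    unfolding gens G by (rule relations)+
  from 1 2 3 4 5 6 show ?thesis by blast
qed

end
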